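(* Let $p$ be a fixed prime. For a positive integer $n$, the number of isomorphism classes of commutative rings with identity that have cardinality $p^{n}$ is $p^{\frac{2}{27}n^{3} + O(n^{5/2})}$.
   Context: Rings are associative; here only commutative rings possessing a multiplicative identity are counted. The prime $p$ is fixed and $n$ varies; a quantity is $p^{a(n)+O(h(n))}$ if it equals $p^{\delta(n)}$ with $|\delta(n)-a(n)|\le C\,h(n)$ for all $n\ge 1$, for some constant $C$ not depending on $n$ ($C$ may depend on $p$). *)

theory Defs
  imports Complex_Main "HOL-Computational_Algebra.Primes" "HOL-Algebra.Weak_Morphisms"
begin

text \<open>Every finite ring has an isomorphic copy with carrier a finite set of natural numbers
  (\<open>comm_rings_of_card_complete\<close> below), so ring structures over \<^typ>\<open>nat\<close> represent all
  isomorphism classes. For \<open>m > 0\<close>, \<open>order R = m\<close> forces the carrier to be finite.\<close>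

definition comm_rings_of_card :: "nat \<Rightarrow> nat ring set"
  where "comm_rings_of_card m = {R. cring R \<and> order R = m}"

definition ring_iso_rel :: "nat \<Rightarrow> (nat ring \<times> nat ring) set"
  where "ring_iso_rel m =
    {(R, S). R \<in> comm_rings_of_card m \<and> S \<in> comm_rings_of_card m \<and> is_ring_iso R S}"

definition num_comm_rings :: "nat \<Rightarrow> nat"
  where "num_comm_rings m = card (comm_rings_of_card m // ring_iso_rel m)"

lemma comm_rings_of_card_complete:
  fixes R :: "'a ring"
  assumes "cring R" "order R = m" "m > 0"
  shows "\<exists>S \<in> comm_rings_of_card m. is_ring_iso R S"
proof -
  interpret cring R by fact
  have "finite (carrier R)"
    using assms by (auto simp: order_def intro: card_ge_0_finite)
  then obtain f :: "'a \<Rightarrow> nat" where f: "inj_on f (carrier R)"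
    using finite_imp_inj_to_nat_seg by blast
  have iso: "f \<in> ring_iso R (image_ring f R)"
    using f by (rule inj_imp_image_ring_iso)
  have "order (image_ring f R) = m"
    using assms(2) f by (simp add: order_def image_ring_carrier card_image)
  moreover have "cring (image_ring f R)"
    using ring_iso_imp_img_cring[OF iso] by (simp add: image_ring_def image_group_def monoid.defs)
  ultimately show ?thesis
    using iso by (auto simp: comm_rings_of_card_def is_ring_iso_def)
qed

lemma equiv_ring_iso_rel: "equiv (comm_rings_of_card m) (ring_iso_rel m)"
proof (rule equivI)
  show "ring_iso_rel m \<subseteq> comm_rings_of_card m \<times> comm_rings_of_card m"
    by (auto simp: ring_iso_rel_def)
  show "refl_on (comm_rings_of_card m) (ring_iso_rel m)"
    by (auto simp: refl_on_def ring_iso_rel_def ring_iso_refl)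
  show "sym (ring_iso_rel m)"
    by (auto simp: sym_def ring_iso_rel_def comm_rings_of_card_def cring_def
        intro: ring_iso_sym)
  show "trans (ring_iso_rel m)"
    by (auto simp: trans_def ring_iso_rel_def intro: ring_iso_trans)
qed

end

theory Submission
  imports Defs "HOL-Algebra.Multiplicative_Group" "HOL-Library.Discrete_Functions"
    "HOL-Number_Theory.Cong"
begin

text \<open>Upper bound. Let \<open>R\<close> have order \<open>p ^ n\<close> and nilradical \<open>J\<close>, and let \<open>M\<close> be the additive
  group generated by \<open>J J\<close>. There are \<open>O(sqrt n)\<close> elements \<open>x\<close> of \<open>J\<close> with \<open>M = \<Sum> x J\<close>:
  choose greedily multipliers of rank above \<open>sqrt n\<close>; once all ranks are at most \<open>m\<close>, a further
  \<open>4 m\<close> elements suffice. Moreover \<open>O(sqrt n)\<close> elements generate \<open>R\<close> modulo \<open>J\<close>. Hence, if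
  \<open>v\<^sub>1, \<dots>, v\<^sub>a\<close> generate \<open>J\<close> modulo \<open>M\<close>, then \<open>R\<close> is generated by \<open>1\<close> and the \<open>v\<^sub>i\<close> as a module
  over a subring with \<open>O(sqrt n)\<close> generators. The ring is therefore determined by the action of
  these generators, which costs \<open>O(n powr (5/2))\<close> digits, and by the products \<open>v\<^sub>i v\<^sub>j \<in> M\<close>, which
  cost \<open>c a (a + 1) / 2\<close> digits where \<open>card M = p ^ c\<close>. As \<open>a + c \<le> n\<close>, the latter is at most
  \<open>2/27 n ^ 3 + O(n ^ 2)\<close>, because \<open>4 (a + c) ^ 3 - 27 a ^ 2 c = (a - 2 c) ^ 2 (4 a + c)\<close>.

  Lower bound. Symmetric bilinear maps \<open>U \<times> U \<rightarrow> W\<close> over the field with \<open>p\<close> elements, with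
  \<open>dim W\<close> about \<open>n/3\<close> and \<open>dim U\<close> about \<open>2 n/3\<close>, define local rings with the same additive
  group, and at most \<open>p ^ (n * n)\<close> of these are isomorphic to a given one.\<close>


subsection \<open>Additive subgroups of a finite ring of prime power order\<close>

text \<open>The exponent 5/2 has one source: an operator on the additive group takes about n^2
  digits, and O(sqrt n) operators are recorded. The square root balances two costs. With rank
  threshold m, each greedy multiplier enlarges the subgroup reached so far by more than m powers of
  p, so there are at most n/(m+1) of them, while products of rank at most m cost 4 m further
  multipliers. The obstacle is that a ring of order p^n need not be an algebra over the field with p
  elements. Logarithms of subgroup orders replace dimensions, and triangular bases with carries
  replace coordinates. Generators of J modulo M suffice because J consists of nilpotent elements: a
  Nakayama argument iterates the action of the chosen multipliers until it dies out. The constant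
  2/27 is half of 4/27, the maximum of a^2 c under a + c = 1, attained at a = 2 c. The lower bound
  uses this shape, and there the loss from isomorphisms is only quadratic in the exponent.\<close>

locale finite_p_ring = cring R for R (structure) +
  fixes p n :: nat
  assumes prime_p: "Factorial_Ring.prime p" and order_R: "order R = p ^ n"
begin

lemma p_gt_1: "p > 1"
  using prime_p by (rule prime_gt_1_nat)

lemma finite_R [simp]: "finite (carrier R)"
  using order_R p_gt_1 by (intro card_ge_0_finite) (simp add: order_def)

abbreviation asub :: "'a set \<Rightarrow> bool" where "asub H \<equiv> additive_subgroup H R"

lemma asubI:
  assumes "H \<subseteq> carrier R" "\<zero> \<in> H" "\<And>x y. x \<in> H \<Longrightarrow> y \<in> H \<Longrightarrow> x \<ominus> y \<in> H"
  shows "asub H"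
proof -
  have m: "\<ominus> x \<in> H" if "x \<in> H" for x
    using assms(3)[OF assms(2) that] that assms(1) by (auto simp: minus_eq)
  have a: "x \<oplus> y \<in> H" if "x \<in> H" "y \<in> H" for x y
    using assms(3)[OF that(1) m[OF that(2)]] that assms(1)
    by (metis minus_eq minus_minus subsetD)
  show ?thesis
    using assms m a
    by (intro additive_subgroup.intro subgroup.intro) (auto simp flip: a_inv_def)
qed

lemma asub_subset: "asub H \<Longrightarrow> H \<subseteq> carrier R"
  by (rule additive_subgroup.a_subset)

lemma asub_zero: "asub H \<Longrightarrow> \<zero> \<in> H"
  by (rule additive_subgroup.zero_closed)

lemma asub_add: "asub H \<Longrightarrow> x \<in> H \<Longrightarrow> y \<in> H \<Longrightarrow> x \<oplus> y \<in> H"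
  by (rule additive_subgroup.a_closed)

lemma asub_uminus: "asub H \<Longrightarrow> x \<in> H \<Longrightarrow> \<ominus> x \<in> H"
  by (rule additive_subgroup.a_inv_closed)

lemma asub_minus: "asub H \<Longrightarrow> x \<in> H \<Longrightarrow> y \<in> H \<Longrightarrow> x \<ominus> y \<in> H"
  by (simp add: minus_eq asub_add asub_uminus)

lemma asub_finite: "asub H \<Longrightarrow> finite H"
  using asub_subset finite_subset finite_R by metis

lemma asub_carrier: "asub (carrier R)"
  by (rule asubI) auto

lemma asub_singleton_zero: "asub {\<zero>}"
  by (rule asubI) (auto simp: minus_eq)

lemma asub_Int: "asub H \<Longrightarrow> asub K \<Longrightarrow> asub (H \<inter> K)"
  by (rule asubI) (auto intro: asub_minus simp: asub_zero dest: asub_subset)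

lemma asub_nat_mult: "asub H \<Longrightarrow> x \<in> H \<Longrightarrow> [(k::nat)] \<cdot> x \<in> H"
  by (induction k) (auto simp: asub_zero asub_add)

lemma asub_int_mult: "asub H \<Longrightarrow> x \<in> H \<Longrightarrow> [(k::int)] \<cdot> x \<in> H"
  by (cases "k \<ge> 0") (simp_all add: add_pow_int_ge add_pow_int_lt asub_nat_mult asub_uminus)

lemma set_add_iff: "z \<in> H <+>\<^bsub>R\<^esub> K \<longleftrightarrow> (\<exists>h\<in>H. \<exists>k\<in>K. z = h \<oplus> k)"
  by (auto simp: set_add_def')

lemma asub_set_add: "asub H \<Longrightarrow> asub K \<Longrightarrow> asub (H <+>\<^bsub>R\<^esub> K)"
  by (rule add_additive_subgroups)

lemma set_add_lower1:
  assumes "asub H" "asub K"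
  shows "H \<subseteq> H <+>\<^bsub>R\<^esub> K"
proof
  fix h assume h: "h \<in> H"
  then have "h = h \<oplus> \<zero>" using asub_subset[OF assms(1)] by auto
  then show "h \<in> H <+>\<^bsub>R\<^esub> K" using h asub_zero[OF assms(2)] unfolding set_add_iff by blast
qed

lemma set_add_lower2:
  assumes "asub H" "asub K"
  shows "K \<subseteq> H <+>\<^bsub>R\<^esub> K"
proof
  fix k assume k: "k \<in> K"
  then have "k = \<zero> \<oplus> k" using asub_subset[OF assms(2)] by auto
  then show "k \<in> H <+>\<^bsub>R\<^esub> K" using k asub_zero[OF assms(1)] unfolding set_add_iff by blast
qed

lemma set_add_least: "asub L \<Longrightarrow> H \<subseteq> L \<Longrightarrow> K \<subseteq> L \<Longrightarrow> H <+>\<^bsub>R\<^esub> K \<subseteq> L"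
  unfolding set_add_def' using asub_add by blast

lemma asub_mult_image:
  assumes "x \<in> carrier R" "asub K"
  shows "asub ((\<otimes>) x ` K)"
proof (rule asubI)
  show "(\<otimes>) x ` K \<subseteq> carrier R" using assms asub_subset by blast
  show "\<zero> \<in> (\<otimes>) x ` K" using assms asub_zero by (metis imageI r_null)
  fix u v assume "u \<in> (\<otimes>) x ` K" "v \<in> (\<otimes>) x ` K"
  then obtain a b where ab: "a \<in> K" "b \<in> K" "u = x \<otimes> a" "v = x \<otimes> b" by blast
  then have "a \<in> carrier R" "b \<in> carrier R" using assms asub_subset by auto
  then have "u \<ominus> v = x \<otimes> (a \<ominus> b)" using ab assms(1) by algebra
  then show "u \<ominus> v \<in> (\<otimes>) x ` K" using ab asub_minus[OF assms(2)] by blast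
qed

text \<open>The substitute for dimension: every additive subgroup has order a power of
  \<open>p\<close>, and \<open>multiplicity\<close> extracts the exponent.\<close>

definition logcard :: "'a set \<Rightarrow> nat"
  where "logcard H = multiplicity p (card H)"

lemma card_asub:
  assumes "asub H"
  shows "card H = p ^ logcard H"
proof -
  have "card (rcosets\<^bsub>add_monoid R\<^esub> H) * card H = order (add_monoid R)"
    using add.lagrange assms additive_subgroup.a_subgroup by blast
  then have "card H dvd p ^ n"
    using order_R by (metis dvd_triv_right order_def partial_object.select_convs(1))
  then obtain k where "card H = p ^ k"
    using divides_primepow_nat prime_p by blast
  then show ?thesis
    using prime_p unfolding logcard_def by (simp add: prime_elem_multiplicity_mult_distrib)
qed

lemma logcard_carrier: "logcard (carrier R) = n"
  using card_asub[OF asub_carrier] order_R p_gt_1 unfolding order_def by simp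

lemma logcard_mono: "asub H \<Longrightarrow> asub K \<Longrightarrow> H \<subseteq> K \<Longrightarrow> logcard H \<le> logcard K"
  using card_mono[OF asub_finite, of K H] card_asub p_gt_1 by simp

lemma logcard_le: "asub H \<Longrightarrow> logcard H \<le> n"
  using logcard_mono[OF _ asub_carrier] asub_subset logcard_carrier by metis

lemma logcard_strict_mono: "asub H \<Longrightarrow> asub K \<Longrightarrow> H \<subset> K \<Longrightarrow> logcard H < logcard K"
  using psubset_card_mono[OF asub_finite, of K H] card_asub p_gt_1 by simp

lemma asub_preimage:
  assumes "x \<in> carrier R" "asub K" "asub D"
  shows "asub {k \<in> K. x \<otimes> k \<in> D}"
proof (rule asubI)
  show "{k \<in> K. x \<otimes> k \<in> D} \<subseteq> carrier R" using assms asub_subset by blast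
  show "\<zero> \<in> {k \<in> K. x \<otimes> k \<in> D}" using assms asub_zero by simp
  fix a b assume ab: "a \<in> {k \<in> K. x \<otimes> k \<in> D}" "b \<in> {k \<in> K. x \<otimes> k \<in> D}"
  then have "a \<in> carrier R" "b \<in> carrier R" using assms asub_subset by auto
  then have "x \<otimes> (a \<ominus> b) = x \<otimes> a \<ominus> x \<otimes> b" using assms(1) by algebra
  then show "a \<ominus> b \<in> {k \<in> K. x \<otimes> k \<in> D}" using ab assms asub_minus by auto
qed

text \<open>Rank-nullity for multiplication by \<open>x\<close>, viewed as a map from
  \<open>K\<close> to the quotient by \<open>D\<close>. No quotient is formed: the map (d, k) to d +
  x k is counted on \<open>D \<times> K\<close>, and each of its fibres is a translate of the
  kernel, embedded as (- x l, l).\<close>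

lemma logcard_mult:
  assumes x: "x \<in> carrier R" and K: "asub K" and D: "asub D"
  shows "logcard K + logcard D = logcard (D <+>\<^bsub>R\<^esub> (\<otimes>) x ` K) + logcard {k \<in> K. x \<otimes> k \<in> D}"
proof -
  let ?S = "D <+>\<^bsub>R\<^esub> (\<otimes>) x ` K" and ?L = "{k \<in> K. x \<otimes> k \<in> D}"
  let ?f = "\<lambda>(d, k). d \<oplus> x \<otimes> k"
  have cK: "K \<subseteq> carrier R" and cD: "D \<subseteq> carrier R" using K D asub_subset by auto
  have img: "?f ` (D \<times> K) = ?S" by (force simp: set_add_def')
  have fib: "card {q \<in> D \<times> K. ?f q = s} = card ?L" if s: "s \<in> ?S" for s
  proof -
    obtain d k where dk: "d \<in> D" "k \<in> K" "s = d \<oplus> x \<otimes> k"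
      using s unfolding set_add_iff by blast
    have c: "d \<in> carrier R" "k \<in> carrier R" using dk cK cD by auto
    have "bij_betw (\<lambda>l. (d \<ominus> x \<otimes> l, k \<oplus> l)) ?L {q \<in> D \<times> K. ?f q = s}"
    proof (rule bij_betwI[where g = "\<lambda>(d', k'). k' \<ominus> k"])
      show "(\<lambda>l. (d \<ominus> x \<otimes> l, k \<oplus> l)) \<in> ?L \<rightarrow> {q \<in> D \<times> K. ?f q = s}"
      proof
        fix l assume l: "l \<in> ?L"
        then have cl: "l \<in> carrier R" using cK by auto
        have "d \<ominus> x \<otimes> l \<oplus> x \<otimes> (k \<oplus> l) = d \<oplus> x \<otimes> k"
          using c cl x by algebra
        then show "(d \<ominus> x \<otimes> l, k \<oplus> l) \<in> {q \<in> D \<times> K. ?f q = s}"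
          using l dk asub_minus[OF D] asub_add[OF K] by auto
      qed
      show "(\<lambda>(d', k'). k' \<ominus> k) \<in> {q \<in> D \<times> K. ?f q = s} \<rightarrow> ?L"
      proof
        fix q assume "q \<in> {q \<in> D \<times> K. ?f q = s}"
        then obtain d' k' where q: "q = (d', k')" "d' \<in> D" "k' \<in> K" "d' \<oplus> x \<otimes> k' = s" by auto
        then have c': "d' \<in> carrier R" "k' \<in> carrier R" using cK cD by auto
        have "x \<otimes> (k' \<ominus> k) = (d' \<oplus> x \<otimes> k') \<ominus> d' \<ominus> x \<otimes> k"
          using c c' x by algebra
        also have "\<dots> = (d \<oplus> x \<otimes> k) \<ominus> d' \<ominus> x \<otimes> k" using q dk by simp
        also have "\<dots> = d \<ominus> d'" using c c' x by algebra
        finally have "x \<otimes> (k' \<ominus> k) \<in> D" using asub_minus[OF D] q dk by simp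
        then show "(case q of (d', k') \<Rightarrow> k' \<ominus> k) \<in> ?L" using q dk asub_minus[OF K] by simp
      qed
      show "(case (d \<ominus> x \<otimes> l, k \<oplus> l) of (d', k') \<Rightarrow> k' \<ominus> k) = l" if "l \<in> ?L" for l
      proof -
        have "l \<in> carrier R" using that cK by auto
        then show ?thesis using c by simp algebra
      qed
      fix q assume "q \<in> {q \<in> D \<times> K. ?f q = s}"
      then obtain d' k' where q: "q = (d', k')" "d' \<in> D" "k' \<in> K" "d' \<oplus> x \<otimes> k' = s" by auto
      then have c': "d' \<in> carrier R" "k' \<in> carrier R" using cK cD by auto
      have "d \<ominus> x \<otimes> (k' \<ominus> k) = (d \<oplus> x \<otimes> k) \<ominus> x \<otimes> k'" using c c' x by algebra
      also have "\<dots> = (d' \<oplus> x \<otimes> k') \<ominus> x \<otimes> k'" using q dk by simp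
      also have "\<dots> = d'" using c' x by algebra
      finally have 1: "d \<ominus> x \<otimes> (k' \<ominus> k) = d'" .
      have "k \<oplus> (k' \<ominus> k) = k'" using c c' by algebra
      with 1 show "(\<lambda>l. (d \<ominus> x \<otimes> l, k \<oplus> l)) (case q of (d', k') \<Rightarrow> k' \<ominus> k) = q"
        using q by simp
    qed
    from bij_betw_same_card[OF this] show ?thesis by (rule sym)
  qed
  have fin: "finite (D \<times> K)" using D K asub_finite by simp
  have "card (D \<times> K) = (\<Sum>s\<in>?f ` (D \<times> K). card {q \<in> D \<times> K. ?f q = s})"
    using sum.image_gen[OF fin, of "\<lambda>_. 1::nat" ?f] by simp
  also have "\<dots> = card ?S * card ?L" unfolding img using fib by simp
  finally have "p ^ logcard D * p ^ logcard K = p ^ logcard ?S * p ^ logcard ?L"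
    using card_asub D K asub_set_add[OF D asub_mult_image[OF x K]] asub_preimage[OF x K D]
    by (simp add: card_cartesian_product)
  then have "p ^ (logcard K + logcard D) = p ^ (logcard ?S + logcard ?L)" by (simp add: power_add mult.commute)
  then show ?thesis using p_gt_1 by simp
qed

text \<open>Rank-nullity with \<open>x = \<one>\<close>, where the kernel is the
  intersection.\<close>

lemma logcard_set_add:
  assumes "asub H" "asub K"
  shows "logcard H + logcard K = logcard (H <+>\<^bsub>R\<^esub> K) + logcard (H \<inter> K)"
proof -
  have c: "K \<subseteq> carrier R" using assms asub_subset by auto
  have "(\<otimes>) \<one> ` K = (\<lambda>x. x) ` K" by (rule image_cong) (use c in auto)
  moreover have "{k \<in> K. \<one> \<otimes> k \<in> H} = H \<inter> K" using c by auto
  ultimately show ?thesis using logcard_mult[OF one_closed assms(2,1)] by simp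
qed

end

context finite_p_ring
begin

section \<open>Additive spans and generators modulo a subgroup\<close>

definition add_span :: "'a set \<Rightarrow> 'a set"
  where "add_span S = \<Inter>{H. asub H \<and> S \<subseteq> H}"

lemma asub_add_span:
  assumes "S \<subseteq> carrier R"
  shows "asub (add_span S)"
proof (rule asubI)
  show "add_span S \<subseteq> carrier R"
    using assms asub_carrier unfolding add_span_def by blast
  show "\<zero> \<in> add_span S" unfolding add_span_def using asub_zero by blast
  show "x \<ominus> y \<in> add_span S" if "x \<in> add_span S" "y \<in> add_span S" for x y
    using that asub_minus unfolding add_span_def by blast
qed

lemma add_span_superset: "S \<subseteq> add_span S"
  unfolding add_span_def by blast

lemma add_span_least: "asub H \<Longrightarrow> S \<subseteq> H \<Longrightarrow> add_span S \<subseteq> H"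
  unfolding add_span_def by blast

text \<open>Adjoining an element outside the current subgroup multiplies the order by at least
  \<open>p\<close>. Generation is phrased through all subgroups \<open>L\<close>, ready for use with
  an \<open>L\<close> given by closure conditions.\<close>

lemma relative_generators:
  assumes "asub K" "asub J" "K \<subseteq> J"
  shows "\<exists>Z. finite Z \<and> Z \<subseteq> J \<and> card Z \<le> logcard J - logcard K \<and>
    (\<forall>L. asub L \<longrightarrow> K \<subseteq> L \<longrightarrow> Z \<subseteq> L \<longrightarrow> J \<subseteq> L)"
  using assms
proof (induction "logcard J - logcard K" arbitrary: K rule: less_induct)
  case less
  show ?case
  proof (cases "K = J")
    case True
    then show ?thesis by (intro exI[of _ "{}"]) auto
  next
    case False
    then obtain z where z: "z \<in> J" "z \<notin> K" using less.prems by auto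
    define K1 where "K1 = add_span (insert z K)"
    have sub: "insert z K \<subseteq> carrier R" using z less.prems asub_subset by blast
    have K1: "asub K1" "insert z K \<subseteq> K1" "K1 \<subseteq> J"
      using asub_add_span[OF sub] add_span_superset add_span_least less.prems z unfolding K1_def by auto
    have lt: "logcard K < logcard K1" using logcard_strict_mono less.prems K1 z by blast
    have le: "logcard K1 \<le> logcard J" using logcard_mono K1 less.prems by blast
    have "logcard J - logcard K1 < logcard J - logcard K" using lt le by simp
    from less.hyps[OF this K1(1) less.prems(2) K1(3)] obtain Z
      where Z: "finite Z" "Z \<subseteq> J" "card Z \<le> logcard J - logcard K1"
        "\<forall>L. asub L \<longrightarrow> K1 \<subseteq> L \<longrightarrow> Z \<subseteq> L \<longrightarrow> J \<subseteq> L" by blast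
    show ?thesis
    proof (intro exI[of _ "insert z Z"] conjI allI impI)
      show "card (insert z Z) \<le> logcard J - logcard K"
        using Z lt le card_insert_le_m1[of "logcard J - logcard K" Z z] by simp
      show "J \<subseteq> L" if "asub L" "K \<subseteq> L" "insert z Z \<subseteq> L" for L
        using that Z(4) add_span_least[of L "insert z K"] unfolding K1_def by auto
    qed (use Z z in auto)
  qed
qed

subsection \<open>Generating products by few multipliers\<close>

text \<open>The element \<open>x\<close> is chosen of maximal rank \<open>r\<close>. Comparing the images of \<open>y\<close> and
  \<open>y \<oplus> x\<close>, whose ranks are at most \<open>r\<close>, shows that every \<open>y\<close> has rank at most \<open>r/2\<close>
  as a map from the kernel of \<open>x\<close> to the cokernel of \<open>x\<close>.\<close>

lemma bounded_rank_cover: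
  assumes "asub J" "asub D" "asub K" "K \<subseteq> J"
    and "\<And>y. y \<in> J \<Longrightarrow> logcard (D <+>\<^bsub>R\<^esub> (\<otimes>) y ` K) \<le> logcard D + m"
  shows "\<exists>X. finite X \<and> X \<subseteq> J \<and> card X \<le> 4 * m \<and>
    (\<forall>L. asub L \<longrightarrow> D \<subseteq> L \<longrightarrow> (\<forall>x\<in>X. \<forall>u\<in>J. x \<otimes> u \<in> L) \<longrightarrow> (\<forall>y\<in>J. \<forall>k\<in>K. y \<otimes> k \<in> L))"
  using assms(2-)
proof (induction m arbitrary: D K rule: less_induct)
  case (less m)
  note J = \<open>asub J\<close> and D = \<open>asub D\<close> and K = \<open>asub K\<close>
  have cJ: "J \<subseteq> carrier R" using J asub_subset by blast
  have cK: "K \<subseteq> carrier R" using K asub_subset by blast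
  define rk where "rk y = logcard (D <+>\<^bsub>R\<^esub> (\<otimes>) y ` K)" for y
  have fJ: "finite (rk ` J)" "rk ` J \<noteq> {}" using asub_finite[OF J] asub_zero[OF J] by auto
  then obtain x where x: "x \<in> J" "rk x = Max (rk ` J)"
    using Max_in[OF fJ] by (metis imageE)
  have rk_le: "rk y \<le> rk x" if "y \<in> J" for y
    using fJ x that by simp
  have xR: "x \<in> carrier R" using x cJ by auto
  have img: "asub ((\<otimes>) y ` K)" if "y \<in> J" for y using asub_mult_image K cJ that by blast
  define D' where "D' = D <+>\<^bsub>R\<^esub> (\<otimes>) x ` K"
  define K' where "K' = {k \<in> K. x \<otimes> k \<in> D}"
  have D': "asub D'" unfolding D'_def by (rule asub_set_add[OF D img[OF x(1)]])
  have K': "asub K'" unfolding K'_def by (rule asub_preimage[OF xR K D])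
  have DD': "D \<subseteq> D'" unfolding D'_def by (rule set_add_lower1[OF D img[OF x(1)]])
  define r where "r = logcard D' - logcard D"
  have dmD': "logcard D' = logcard D + r" using logcard_mono[OF D D' DD'] unfolding r_def by simp
  have rm: "r \<le> m" using less.prems(4)[OF x(1)] dmD' unfolding D'_def by simp
  have dmK: "logcard K = logcard K' + r"
    using logcard_mult[OF xR K D] dmD' unfolding D'_def K'_def by simp
  show ?case
  proof (cases "r = 0")
    case True
    have "y \<otimes> k \<in> D" if "y \<in> J" "k \<in> K" for y k
    proof -
      have a: "asub (D <+>\<^bsub>R\<^esub> (\<otimes>) y ` K)" by (rule asub_set_add[OF D img[OF that(1)]])
      have "logcard (D <+>\<^bsub>R\<^esub> (\<otimes>) y ` K) \<le> logcard D"
        using rk_le[OF that(1)] True dmD' unfolding rk_def D'_def by simp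
      then have "D = D <+>\<^bsub>R\<^esub> (\<otimes>) y ` K"
        using logcard_strict_mono[OF D a] set_add_lower1[OF D img[OF that(1)]] by fastforce
      then show ?thesis using set_add_lower2[OF D img[OF that(1)]] that by blast
    qed
    then show ?thesis by (intro exI[of _ "{}"]) auto
  next
    case False
    have half: "logcard (D' <+>\<^bsub>R\<^esub> (\<otimes>) y ` K') \<le> logcard D' + r div 2" if y: "y \<in> J" for y
    proof -
      have yR: "y \<in> carrier R" using y cJ by auto
      have yx: "y \<oplus> x \<in> J" using asub_add[OF J] x y by blast
      define I0 where "I0 = D <+>\<^bsub>R\<^esub> (\<otimes>) y ` K"
      define I1 where "I1 = D <+>\<^bsub>R\<^esub> (\<otimes>) (y \<oplus> x) ` K"
      \<comment> \<open>The images \<open>I0\<close> and \<open>I1\<close> are compared by the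
        modular law: their sum contains \<open>B\<close>, while their intersection only contains
        \<open>A\<close>, the image of \<open>K'\<close> before enlarging \<open>D\<close> to
        \<open>D'\<close>.\<close>
      define A where "A = D <+>\<^bsub>R\<^esub> (\<otimes>) y ` K'"
      define B where "B = D' <+>\<^bsub>R\<^esub> (\<otimes>) y ` K'"
      have yK': "asub ((\<otimes>) y ` K')" by (rule asub_mult_image[OF yR K'])
      have I0: "asub I0" "D \<subseteq> I0" "(\<otimes>) y ` K \<subseteq> I0"
        unfolding I0_def using asub_set_add set_add_lower1 set_add_lower2 D img[OF y] by auto
      have I1: "asub I1" "D \<subseteq> I1" "(\<otimes>) (y \<oplus> x) ` K \<subseteq> I1"
        unfolding I1_def using asub_set_add set_add_lower1 set_add_lower2 D img[OF yx] by auto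
      have A: "asub A" "D \<subseteq> A" "(\<otimes>) y ` K' \<subseteq> A"
        unfolding A_def using asub_set_add set_add_lower1 set_add_lower2 D yK' by auto
      have B: "asub B" unfolding B_def by (rule asub_set_add[OF D' yK'])
      have S: "asub (I0 <+>\<^bsub>R\<^esub> I1)" by (rule asub_set_add[OF I0(1) I1(1)])
      have I0S: "I0 \<subseteq> I0 <+>\<^bsub>R\<^esub> I1" and I1S: "I1 \<subseteq> I0 <+>\<^bsub>R\<^esub> I1"
        using set_add_lower1 set_add_lower2 I0(1) I1(1) by auto
      have distr: "(y \<oplus> x) \<otimes> k = y \<otimes> k \<oplus> x \<otimes> k" if "k \<in> K" for k
        using that cK xR yR l_distr by blast
      have "x \<otimes> k \<in> I0 <+>\<^bsub>R\<^esub> I1" if k: "k \<in> K" for k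
      proof -
        have c: "k \<in> carrier R" using k cK by auto
        have "(y \<oplus> x) \<otimes> k \<ominus> y \<otimes> k \<in> I0 <+>\<^bsub>R\<^esub> I1"
          using asub_minus[OF S] I1(3) I1S I0(3) I0S k by blast
        moreover have "(y \<oplus> x) \<otimes> k \<ominus> y \<otimes> k = x \<otimes> k"
          using c xR yR by algebra
        ultimately show ?thesis by simp
      qed
      then have "D' \<subseteq> I0 <+>\<^bsub>R\<^esub> I1"
        unfolding D'_def using I0(2) I0S by (intro set_add_least[OF S]) auto
      then have "B \<subseteq> I0 <+>\<^bsub>R\<^esub> I1"
        unfolding B_def K'_def using I0(3) I0S by (intro set_add_least[OF S]) auto
      then have 1: "logcard B \<le> logcard (I0 <+>\<^bsub>R\<^esub> I1)" by (rule logcard_mono[OF B S])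
      have "y \<otimes> k \<in> I1" if k: "k \<in> K'" for k
      proof -
        have kK: "k \<in> K" "x \<otimes> k \<in> D" using k unfolding K'_def by auto
        then have c: "k \<in> carrier R" using cK by auto
        have "(y \<oplus> x) \<otimes> k \<ominus> x \<otimes> k \<in> I1"
          using asub_minus[OF I1(1)] I1(2,3) kK by blast
        moreover have "(y \<oplus> x) \<otimes> k \<ominus> x \<otimes> k = y \<otimes> k"
          using c xR yR by algebra
        ultimately show ?thesis by simp
      qed
      then have "A \<subseteq> I0 \<inter> I1"
        unfolding A_def K'_def using I0 I1
        by (intro set_add_least[OF asub_Int[OF I0(1) I1(1)]]) auto
      then have 2: "logcard A \<le> logcard (I0 \<inter> I1)" by (rule logcard_mono[OF A(1) asub_Int[OF I0(1) I1(1)]])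
      have AD': "asub (A <+>\<^bsub>R\<^esub> D')" by (rule asub_set_add[OF A(1) D'])
      have "B \<subseteq> A <+>\<^bsub>R\<^esub> D'"
        unfolding B_def using A set_add_lower1[OF A(1) D'] set_add_lower2[OF A(1) D']
        by (intro set_add_least[OF AD']) auto
      then have "logcard B \<le> logcard (A <+>\<^bsub>R\<^esub> D')" by (rule logcard_mono[OF B AD'])
      moreover have "logcard D \<le> logcard (A \<inter> D')"
        using logcard_mono[OF D asub_Int[OF A(1) D']] A(2) DD' by simp
      ultimately have 3: "logcard B + logcard D \<le> logcard A + logcard D'"
        using logcard_set_add[OF A(1) D'] by simp
      have "logcard I0 \<le> logcard D'" "logcard I1 \<le> logcard D'"
        using rk_le[OF y] rk_le[OF yx] unfolding rk_def I0_def I1_def D'_def by auto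
      then have "logcard B + logcard A \<le> 2 * logcard D'"
        using 1 2 logcard_set_add[OF I0(1) I1(1)] by simp
      \<comment> \<open>Adding \<open>3\<close> cancels the size of \<open>A\<close>. Writing sizes
        for logarithms, 2 B \<le> 3 D' - D = 2 D' + r.\<close>
      then show ?thesis using 3 dmD' unfolding B_def by simp
    qed
    have "r div 2 < m" using rm False by simp
    moreover have "K' \<subseteq> J" using less.prems unfolding K'_def by auto
    ultimately obtain X where X: "finite X" "X \<subseteq> J" "card X \<le> 4 * (r div 2)"
      "\<forall>L. asub L \<longrightarrow> D' \<subseteq> L \<longrightarrow> (\<forall>x\<in>X. \<forall>u\<in>J. x \<otimes> u \<in> L) \<longrightarrow>
        (\<forall>y\<in>J. \<forall>k\<in>K'. y \<otimes> k \<in> L)"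
      using less.IH[OF _ D' K' _ half] by blast
    have "K' \<subseteq> K" unfolding K'_def by auto
    from relative_generators[OF K' K this] obtain Z
      where Z: "finite Z" "Z \<subseteq> K" "card Z \<le> logcard K - logcard K'"
        "\<forall>L. asub L \<longrightarrow> K' \<subseteq> L \<longrightarrow> Z \<subseteq> L \<longrightarrow> K \<subseteq> L"
      by blast
    have Zr: "card Z \<le> r" using Z(3) dmK by simp
    show ?thesis
    proof (intro exI[of _ "insert x (X \<union> Z)"] conjI allI impI ballI)
      \<comment> \<open>One element for \<open>x\<close>, at most 2 r for the recursive call, and r
        for \<open>Z\<close>, since \<open>K'\<close> has index p^r in \<open>K\<close>. As r \<ge>
        1, the sum 3 r + 1 is at most 4 r, which explains the constant 4.\<close>
      have "card (insert x (X \<union> Z)) \<le> Suc (card X + card Z)"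
        using card_Un_le[of X Z] X(1) Z(1) by (simp add: card_insert_if)
      also have "\<dots> \<le> 4 * m" using X(3) Zr rm False by linarith
      finally show "card (insert x (X \<union> Z)) \<le> 4 * m" .
    next
      fix L y k
      assume L: "asub L" "D \<subseteq> L" "\<forall>x'\<in>insert x (X \<union> Z). \<forall>u\<in>J. x' \<otimes> u \<in> L"
        and y: "y \<in> J" and k: "k \<in> K"
      have yR: "y \<in> carrier R" using y cJ by auto
      have "D' \<subseteq> L" unfolding D'_def
        using L less.prems(3) by (intro set_add_least) auto
      then have K'L: "K' \<subseteq> {k \<in> K. y \<otimes> k \<in> L}"
        using X(4) L(1,3) y \<open>K' \<subseteq> K\<close> by blast
      \<comment> \<open>Commutativity lets generators of the domain act as multipliers:
        \<open>L\<close> contains z u for all u in \<open>J\<close>, hence contains y z although y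
        was not chosen.\<close>
      have "y \<otimes> z = z \<otimes> y" if "z \<in> Z" for z
        using that Z cK yR m_comm by blast
      then have "Z \<subseteq> {k \<in> K. y \<otimes> k \<in> L}" using L(3) Z(2) y by auto
      then show "y \<otimes> k \<in> L" using Z(4) asub_preimage[OF yR K L(1)] K'L k by blast
    qed (use X Z x less.prems in auto)
  qed
qed

text \<open>Take \<open>X\<close> of largest cardinality among the sets satisfying \<open>P\<close>.
  An element of rank above \<open>m\<close> over the span of its products could be adjoined without
  violating \<open>P\<close>, so none exists.\<close>

lemma greedy_rank:
  assumes J: "asub J"
  shows "\<exists>X D. finite X \<and> X \<subseteq> J \<and> card X * Suc m \<le> n \<and> asub D \<and>
    (\<forall>L. asub L \<longrightarrow> (\<forall>x\<in>X. \<forall>u\<in>J. x \<otimes> u \<in> L) \<longrightarrow> D \<subseteq> L) \<and>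
    (\<forall>y\<in>J. logcard (D <+>\<^bsub>R\<^esub> (\<otimes>) y ` J) \<le> logcard D + m)"
proof -
  have cJ: "J \<subseteq> carrier R" using J asub_subset by blast
  define sp where "sp X = add_span (\<Union>x\<in>X. (\<otimes>) x ` J)" for X
  define P where "P X \<longleftrightarrow> X \<subseteq> J \<and> card X * Suc m \<le> logcard (sp X)" for X
  have "P {}" unfolding P_def by simp
  moreover have "card X < Suc (card J)" if "P X" for X
    using that card_mono[OF asub_finite[OF J]] unfolding P_def by (simp add: le_imp_less_Suc)
  ultimately obtain X where X: "P X" and max: "\<And>Y. P Y \<Longrightarrow> card Y \<le> card X"
    using ex_has_greatest_nat[of P "{}" card "Suc (card J)"] by blast
  have XJ: "X \<subseteq> J" using X unfolding P_def by simp
  have sub: "(\<Union>x\<in>Y. (\<otimes>) x ` J) \<subseteq> carrier R" if "Y \<subseteq> J" for Y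
    using that cJ by blast
  have a: "asub (sp Y)" if "Y \<subseteq> J" for Y unfolding sp_def by (rule asub_add_span[OF sub[OF that]])
  have sup: "(\<otimes>) x ` J \<subseteq> sp Y" if "x \<in> Y" for x Y
    using add_span_superset[of "\<Union>x\<in>Y. (\<otimes>) x ` J"] that unfolding sp_def by blast
  have "logcard (sp X <+>\<^bsub>R\<^esub> (\<otimes>) y ` J) \<le> logcard (sp X) + m" if y: "y \<in> J" for y
  proof (rule ccontr)
    assume big: "\<not> ?thesis"
    have ya: "asub ((\<otimes>) y ` J)" using asub_mult_image J cJ y by blast
    have "y \<notin> X"
    proof
      assume "y \<in> X"
      then have "sp X <+>\<^bsub>R\<^esub> (\<otimes>) y ` J \<subseteq> sp X"
        using set_add_least[OF a[OF XJ] order_refl sup] by blast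
      then show False
        using big logcard_mono[OF asub_set_add[OF a[OF XJ] ya] a[OF XJ]] by simp
    qed
    have yXJ: "insert y X \<subseteq> J" using XJ y by simp
    have "sp X \<subseteq> sp (insert y X)"
      using add_span_least[OF a[OF yXJ], of "\<Union>x\<in>X. (\<otimes>) x ` J"] sup[of _ "insert y X"]
      unfolding sp_def[of X] by blast
    then have "sp X <+>\<^bsub>R\<^esub> (\<otimes>) y ` J \<subseteq> sp (insert y X)"
      using set_add_least[OF a[OF yXJ]] sup[of y "insert y X"] by blast
    then have "logcard (sp X <+>\<^bsub>R\<^esub> (\<otimes>) y ` J) \<le> logcard (sp (insert y X))"
      by (rule logcard_mono[OF asub_set_add[OF a[OF XJ] ya] a[OF yXJ]])
    then have "P (insert y X)"
      using big X \<open>y \<notin> X\<close> y finite_subset[OF XJ asub_finite[OF J]] unfolding P_def by simp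
    from max[OF this] show False
      using \<open>y \<notin> X\<close> finite_subset[OF XJ asub_finite[OF J]] by simp
  qed
  moreover have "card X * Suc m \<le> n"
    using X logcard_le[OF a[OF XJ]] unfolding P_def by (meson le_trans)
  moreover have "sp X \<subseteq> L" if "asub L" "\<forall>x\<in>X. \<forall>u\<in>J. x \<otimes> u \<in> L" for L
    unfolding sp_def using that by (intro add_span_least) auto
  ultimately show ?thesis
    using XJ finite_subset[OF XJ asub_finite[OF J]] a[OF XJ] by blast
qed

text \<open>With m = \<open>floor_sqrt n\<close>, the inequality n < (m + 1)^2 leaves at most m
  greedy multipliers; the bounded-rank part adds 4 m.\<close>

lemma few_multipliers:
  assumes J: "asub J"
  shows "\<exists>X. finite X \<and> X \<subseteq> J \<and> card X \<le> 5 * floor_sqrt n \<and>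
    (\<forall>L. asub L \<longrightarrow> (\<forall>x\<in>X. \<forall>u\<in>J. x \<otimes> u \<in> L) \<longrightarrow> (\<forall>y\<in>J. \<forall>k\<in>J. y \<otimes> k \<in> L))"
proof -
  define m where "m = floor_sqrt n"
  obtain X D where X: "finite X" "X \<subseteq> J" "card X * Suc m \<le> n" and D: "asub D"
    "\<forall>L. asub L \<longrightarrow> (\<forall>x\<in>X. \<forall>u\<in>J. x \<otimes> u \<in> L) \<longrightarrow> D \<subseteq> L"
    "\<forall>y\<in>J. logcard (D <+>\<^bsub>R\<^esub> (\<otimes>) y ` J) \<le> logcard D + m"
    using greedy_rank[OF J, of m] by blast
  obtain Y where Y: "finite Y" "Y \<subseteq> J" "card Y \<le> 4 * m"
    "\<forall>L. asub L \<longrightarrow> D \<subseteq> L \<longrightarrow> (\<forall>x\<in>Y. \<forall>u\<in>J. x \<otimes> u \<in> L) \<longrightarrow>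
      (\<forall>y\<in>J. \<forall>k\<in>J. y \<otimes> k \<in> L)"
    using bounded_rank_cover[OF J D(1) J order_refl bspec[OF D(3)]] by blast
  have "n < Suc m * Suc m"
    using Suc_floor_sqrt_power2_gt[of n] unfolding m_def by (simp add: power2_eq_square)
  then have "card X * Suc m < Suc m * Suc m" using X(3) by linarith
  then have "card X < Suc m" by (meson mult_less_cancel2)
  moreover have "card (X \<union> Y) \<le> card X + card Y" by (rule card_Un_le)
  ultimately have "card (X \<union> Y) \<le> 5 * m" using Y(3) by linarith
  moreover have "\<forall>y\<in>J. \<forall>k\<in>J. y \<otimes> k \<in> L"
    if "asub L" "\<forall>x\<in>X \<union> Y. \<forall>u\<in>J. x \<otimes> u \<in> L" for L
  proof -
    have "D \<subseteq> L" using that D(2) by simp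
    then show ?thesis using that Y(4) by simp
  qed
  ultimately show ?thesis using X Y unfolding m_def by (intro exI[of _ "X \<union> Y"]) blast
qed

end

context finite_p_ring
begin

subsection \<open>Maximal ideals and the nilradical\<close>

lemma ideal_asub: "ideal I R \<Longrightarrow> asub I"
  by (rule ideal.axioms)

lemma ideal_mult: "ideal I R \<Longrightarrow> a \<in> I \<Longrightarrow> r \<in> carrier R \<Longrightarrow> r \<otimes> a \<in> I"
  by (rule ideal.I_l_closed)

lemma exists_maximalideal_superset:
  assumes I: "ideal I R" "I \<noteq> carrier R"
  shows "\<exists>m. maximalideal m R \<and> I \<subseteq> m"
proof -
  define P where "P m \<longleftrightarrow> ideal m R \<and> m \<noteq> carrier R \<and> I \<subseteq> m" for m
  have sub: "m \<subseteq> carrier R" if "P m" for m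
    using that ideal_asub asub_subset unfolding P_def by blast
  then have "card m < Suc (card (carrier R))" if "P m" for m
    using that card_mono[OF finite_R] by (simp add: le_imp_less_Suc)
  moreover have "P I" using I unfolding P_def by simp
  ultimately obtain m where m: "P m" and max: "\<And>m'. P m' \<Longrightarrow> card m' \<le> card m"
    using ex_has_greatest_nat[of P I card "Suc (card (carrier R))"] by blast
  have "maximalideal m R"
  proof (rule maximalidealI)
    show "ideal m R" "carrier R \<noteq> m" using m unfolding P_def by auto
    fix J assume J: "ideal J R" "m \<subseteq> J" "J \<subseteq> carrier R"
    show "J = m \<or> J = carrier R"
    proof (rule disjCI)
      assume "J \<noteq> carrier R"
      then have "P J" using J m unfolding P_def by blast
      then show "J = m" using max[of J] J asub_finite[OF ideal_asub[OF J(1)]]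
        by (metis card_seteq)
    qed
  qed
  then show ?thesis using m unfolding P_def by blast
qed

lemma unit_if_avoids_maximal:
  assumes u: "u \<in> carrier R" and avoid: "\<And>m. maximalideal m R \<Longrightarrow> u \<notin> m"
  shows "\<exists>v \<in> carrier R. v \<otimes> u = \<one>"
proof -
  have "PIdl u = carrier R"
    using exists_maximalideal_superset[OF cgenideal_ideal[OF u]] cgenideal_self[OF u] avoid
    by blast
  then have "\<one> \<in> PIdl u" by simp
  then show ?thesis unfolding cgenideal_def by auto
qed

definition max_ideals :: "'a set set" where "max_ideals = {m. maximalideal m R}"

text \<open>Literally the Jacobson radical; finiteness makes its elements nilpotent, which justifies
  the name.\<close>

definition nilrad :: "'a set" where "nilrad = {r \<in> carrier R. \<forall>m\<in>max_ideals. r \<in> m}"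

lemma max_ideals_ideal: "m \<in> max_ideals \<Longrightarrow> ideal m R"
  unfolding max_ideals_def using maximalideal.axioms by blast

lemma max_ideals_subset: "m \<in> max_ideals \<Longrightarrow> m \<subseteq> carrier R"
  using max_ideals_ideal ideal_asub asub_subset by blast

lemma finite_max_ideals: "finite max_ideals"
  by (rule finite_subset[of _ "Pow (carrier R)"]) (use max_ideals_subset in auto)

lemma one_notin_max_ideals: "m \<in> max_ideals \<Longrightarrow> \<one> \<notin> m"
  using ideal.one_imp_carrier[OF max_ideals_ideal] maximalideal.I_notcarr unfolding max_ideals_def by blast

lemma asub_nilrad: "asub nilrad"
proof (rule asubI)
  show "\<zero> \<in> nilrad" unfolding nilrad_def using asub_zero[OF ideal_asub[OF max_ideals_ideal]] by simp
  show "x \<ominus> y \<in> nilrad" if "x \<in> nilrad" "y \<in> nilrad" for x y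
    using that asub_minus[OF ideal_asub[OF max_ideals_ideal]] unfolding nilrad_def by simp
qed (auto simp: nilrad_def)

lemma nilrad_mult: "r \<in> carrier R \<Longrightarrow> j \<in> nilrad \<Longrightarrow> r \<otimes> j \<in> nilrad"
  unfolding nilrad_def using ideal_mult[OF max_ideals_ideal] by simp

text \<open>By finiteness two powers agree, say j^a = j^(a+d) with d > 0, so 1 - j^d annihilates
  j^a. This factor lies in no maximal ideal and is therefore invertible.\<close>

lemma nilrad_nilpotent:
  assumes j: "j \<in> nilrad"
  shows "\<exists>N::nat. j [^] N = \<zero>"
proof -
  have jR: "j \<in> carrier R" using j unfolding nilrad_def by simp
  have "\<not> inj (\<lambda>N::nat. j [^] N)"
  proof
    assume "inj (\<lambda>N::nat. j [^] N)"
    moreover have "range (\<lambda>N::nat. j [^] N) \<subseteq> carrier R" using jR by auto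
    ultimately have "finite (UNIV :: nat set)"
      using finite_subset[OF _ finite_R] finite_imageD by metis
    then show False by simp
  qed
  then obtain a b :: nat where ab: "a < b" "j [^] a = j [^] b"
    unfolding inj_def by (metis linorder_neqE_nat)
  define d where "d = b - a"
  have d: "d > 0" "b = a + d" using ab unfolding d_def by auto
  have dj: "j [^] d \<in> nilrad"
    using d(1) nilrad_mult[of "j [^] (d - 1)" j] j jR nat_pow_Suc[of j "d - 1"] by simp
  define u where "u = \<one> \<ominus> j [^] d"
  have uR: "u \<in> carrier R" using jR unfolding u_def by simp
  have "u \<notin> m" if "maximalideal m R" for m
  proof
    assume um: "u \<in> m"
    have m: "m \<in> max_ideals" using that unfolding max_ideals_def by simp
    have "u \<oplus> j [^] d \<in> m"
      using asub_add[OF ideal_asub[OF max_ideals_ideal[OF m]] um] dj m unfolding nilrad_def by simp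
    moreover have "u \<oplus> j [^] d = \<one>" unfolding u_def using jR nat_pow_closed[OF jR, of d] by algebra
    ultimately show False using one_notin_max_ideals[OF m] by simp
  qed
  then obtain v where v: "v \<in> carrier R" "v \<otimes> u = \<one>"
    using unit_if_avoids_maximal[OF uR] by blast
  have c: "j [^] a \<in> carrier R" "j [^] d \<in> carrier R" using jR by auto
  have "j [^] a \<otimes> u = j [^] a \<ominus> j [^] a \<otimes> j [^] d"
    unfolding u_def using c by algebra
  also have "\<dots> = j [^] a \<ominus> j [^] a" using ab(2) d(2) nat_pow_mult[OF jR, of a d] by simp
  also have "\<dots> = \<zero>" using c by algebra
  finally have z: "j [^] a \<otimes> u = \<zero>" .
  have "j [^] a = j [^] a \<otimes> (v \<otimes> u)" using v c by simp
  also have "\<dots> = v \<otimes> (j [^] a \<otimes> u)" using v(1) c uR by algebra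
  also have "\<dots> = \<zero>" using z v by simp
  finally show ?thesis by blast
qed

section \<open>Congruences, Chinese remainders and residue fields\<close>

lemma congr_mult:
  assumes "ideal m R" "x \<in> carrier R" "x' \<in> carrier R" "y \<in> carrier R" "y' \<in> carrier R"
    "x \<ominus> x' \<in> m" "y \<ominus> y' \<in> m"
  shows "x \<otimes> y \<ominus> x' \<otimes> y' \<in> m"
proof -
  have "x \<otimes> y \<ominus> x' \<otimes> y' = y \<otimes> (x \<ominus> x') \<oplus> x' \<otimes> (y \<ominus> y')"
    using assms(2-5) by algebra
  then show ?thesis using assms ideal_mult asub_add[OF ideal_asub] by simp
qed

lemma congr_refl: "ideal m R \<Longrightarrow> x \<in> carrier R \<Longrightarrow> x \<ominus> x \<in> m"
  using asub_zero[OF ideal_asub] by (simp add: minus_eq r_neg)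

lemma congr_trans:
  assumes "ideal m R" "x \<in> carrier R" "y \<in> carrier R" "z \<in> carrier R" "x \<ominus> y \<in> m" "y \<ominus> z \<in> m"
  shows "x \<ominus> z \<in> m"
proof -
  have "x \<ominus> z = (x \<ominus> y) \<oplus> (y \<ominus> z)" using assms(2-4) by algebra
  then show ?thesis using asub_add[OF ideal_asub[OF assms(1)] assms(5,6)] by simp
qed

lemma congr_sym:
  assumes "ideal m R" "x \<in> carrier R" "y \<in> carrier R" "x \<ominus> y \<in> m"
  shows "y \<ominus> x \<in> m"
proof -
  have "y \<ominus> x = \<ominus> (x \<ominus> y)" using assms(2,3) by algebra
  then show ?thesis using asub_uminus[OF ideal_asub[OF assms(1)] assms(4)] by simp
qed

lemma congr_pow:
  assumes "ideal m R" "x \<in> carrier R" "x' \<in> carrier R" "x \<ominus> x' \<in> m"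
  shows "x [^] (k::nat) \<ominus> x' [^] k \<in> m"
  by (induction k) (use assms in \<open>simp_all add: congr_refl congr_mult\<close>)

text \<open>Two distinct maximal ideals \<open>m\<close>, \<open>m'\<close> sum to the ring, so 1 =
  a + d with a in \<open>m\<close> and d in \<open>m'\<close>. The product of these d over
  \<open>F\<close> is congruent to 1 modulo \<open>m\<close>.\<close>

lemma separating_element:
  assumes m: "m \<in> max_ideals" and F: "F \<subseteq> max_ideals - {m}"
  shows "\<exists>e\<in>carrier R. e \<ominus> \<one> \<in> m \<and> (\<forall>m'\<in>F. e \<in> m')"
proof -
  have "finite F" using F finite_max_ideals finite_subset by blast
  then show ?thesis using F
  proof (induction F rule: finite_induct)
    case empty
    then show ?case by (intro bexI[of _ \<one>]) (auto simp: congr_refl max_ideals_ideal[OF m])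
  next
    case (insert m' F)
    then obtain e where e: "e \<in> carrier R" "e \<ominus> \<one> \<in> m" "\<forall>m'\<in>F. e \<in> m'" by auto
    have m': "m' \<in> max_ideals" "m' \<noteq> m" using insert by auto
    have S: "ideal (m <+>\<^bsub>R\<^esub> m') R" by (rule add_ideals[OF max_ideals_ideal[OF m] max_ideals_ideal[OF m'(1)]])
    have am: "asub m" "asub m'" using m m' max_ideals_ideal ideal_asub by auto
    have up: "m \<subseteq> m <+>\<^bsub>R\<^esub> m'" "m' \<subseteq> m <+>\<^bsub>R\<^esub> m'" using set_add_lower1 set_add_lower2 am by auto
    have mm: "maximalideal m R" "maximalideal m' R" using m m'(1) unfolding max_ideals_def by auto
    have SR: "m <+>\<^bsub>R\<^esub> m' \<subseteq> carrier R" by (rule asub_subset[OF ideal_asub[OF S]])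
    have "m <+>\<^bsub>R\<^esub> m' = carrier R"
    proof (rule ccontr)
      assume "\<not> ?thesis"
      then have "m <+>\<^bsub>R\<^esub> m' = m" "m <+>\<^bsub>R\<^esub> m' = m'"
        using maximalideal.I_maximal[OF mm(1) S up(1) SR]
          maximalideal.I_maximal[OF mm(2) S up(2) SR] by auto
      then show False using m'(2) by simp
    qed
    then have "\<one> \<in> m <+>\<^bsub>R\<^esub> m'" by simp
    then obtain a d where ad: "a \<in> m" "d \<in> m'" "\<one> = a \<oplus> d" unfolding set_add_iff by blast
    have c: "a \<in> carrier R" "d \<in> carrier R" using ad am asub_subset by auto
    have "d \<ominus> \<one> = \<ominus> a" unfolding ad(3) using c by algebra
    then have "d \<ominus> \<one> \<in> m" using asub_uminus[OF am(1) ad(1)] by simp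
    then have "e \<otimes> d \<ominus> \<one> \<otimes> \<one> \<in> m"
      using congr_mult[OF max_ideals_ideal[OF m] e(1) one_closed c(2) one_closed e(2)] by blast
    then have "e \<otimes> d \<ominus> \<one> \<in> m" by simp
    moreover have "e \<otimes> d \<in> m'" using ideal_mult[OF max_ideals_ideal[OF m'(1)] ad(2) e(1)] .
    moreover have "e \<otimes> d \<in> m''" if "m'' \<in> F" for m''
    proof -
      have "d \<otimes> e \<in> m''" using ideal_mult[OF max_ideals_ideal _ c(2)] e(3) that insert.prems by blast
      then show ?thesis using m_comm[OF c(2) e(1)] by simp
    qed
    ultimately show ?case using e(1) c(2) by (intro bexI[of _ "e \<otimes> d"]) auto
  qed
qed

text \<open>One ideal is treated at a time: the correction e (f m - r), with e a separating element,
  repairs the residue at the new ideal and vanishes at the earlier ones.\<close>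

lemma chinese_remainder:
  assumes f: "\<And>m. m \<in> max_ideals \<Longrightarrow> f m \<in> carrier R"
  shows "\<exists>r\<in>carrier R. \<forall>m\<in>max_ideals. r \<ominus> f m \<in> m"
proof -
  have "\<exists>r\<in>carrier R. \<forall>m\<in>F. r \<ominus> f m \<in> m" if "finite F" "F \<subseteq> max_ideals" for F
    using that
  proof (induction F rule: finite_induct)
    case (insert m F)
    then obtain r where r: "r \<in> carrier R" "\<forall>m\<in>F. r \<ominus> f m \<in> m" by auto
    have m: "m \<in> max_ideals" "F \<subseteq> max_ideals - {m}" using insert by auto
    from separating_element[OF m] obtain e
      where e: "e \<in> carrier R" "e \<ominus> \<one> \<in> m" "\<forall>m'\<in>F. e \<in> m'" by blast
    have fm: "f m \<in> carrier R" using f m by blast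
    let ?r = "r \<oplus> e \<otimes> (f m \<ominus> r)"
    have "?r \<ominus> f m = (f m \<ominus> r) \<otimes> (e \<ominus> \<one>)" using r(1) e(1) fm by algebra
    then have 1: "?r \<ominus> f m \<in> m" using ideal_mult[OF max_ideals_ideal[OF m(1)] e(2)] fm r(1) by simp
    have 2: "?r \<ominus> f m' \<in> m'" if m': "m' \<in> F" for m'
    proof -
      have m'M: "m' \<in> max_ideals" using m' m by auto
      have fm': "f m' \<in> carrier R" using f m'M by blast
      have "?r \<ominus> f m' = (r \<ominus> f m') \<oplus> (f m \<ominus> r) \<otimes> e" using r(1) e(1) fm fm' by algebra
      moreover have "(f m \<ominus> r) \<otimes> e \<in> m'"
        using ideal_mult[OF max_ideals_ideal[OF m'M]] e(3) m' fm r(1) by simp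
      ultimately show ?thesis
        using asub_add[OF ideal_asub[OF max_ideals_ideal[OF m'M]]] r(2) m' by simp
    qed
    show ?case using 1 2 r(1) e(1) fm by (intro bexI[of _ ?r]) auto
  qed auto
  then show ?thesis using finite_max_ideals by blast
qed

text \<open>Lifts of the indicator functions of sets of maximal ideals are distinct ring elements,
  so 2 ^ \<open>card max_ideals\<close> \<le> p ^ n. The crude p \<le> 2 ^ p is affordable because
  the final constant may depend on p.\<close>

lemma card_max_ideals: "card max_ideals \<le> p * n"
proof -
  have "\<exists>r\<in>carrier R. \<forall>m\<in>max_ideals. r \<ominus> (if m \<in> S then \<one> else \<zero>) \<in> m" for S
    by (rule chinese_remainder) auto
  then obtain r where r: "\<And>S. r S \<in> carrier R"
    "\<And>S m. m \<in> max_ideals \<Longrightarrow> r S \<ominus> (if m \<in> S then \<one> else \<zero>) \<in> m" by metis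
  have sub: "S \<subseteq> T" if "S \<subseteq> max_ideals" "r S = r T" for S T
  proof
    fix m assume m: "m \<in> S"
    show "m \<in> T"
    proof (rule ccontr)
      assume "m \<notin> T"
      have mM: "m \<in> max_ideals" using m that by auto
      have "r S \<ominus> \<one> \<in> m" "r S \<ominus> \<zero> \<in> m"
        using r(2)[OF mM, of S] r(2)[OF mM, of T] m \<open>m \<notin> T\<close> that(2) by auto
      moreover have "\<one> = (r S \<ominus> \<zero>) \<ominus> (r S \<ominus> \<one>)" using r(1)[of S] by algebra
      ultimately show False
        using asub_minus[OF ideal_asub[OF max_ideals_ideal[OF mM]]] one_notin_max_ideals[OF mM] by metis
    qed
  qed
  have "inj_on r (Pow max_ideals)"
  proof (rule inj_onI)
    fix S T assume "S \<in> Pow max_ideals" "T \<in> Pow max_ideals" "r S = r T"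
    then show "S = T" using sub[of S T] sub[of T S] by auto
  qed
  then have "card (Pow max_ideals) \<le> card (carrier R)"
    using r(1) by (intro card_inj_on_le[OF _ _ finite_R]) auto
  then have "2 ^ card max_ideals \<le> p ^ n"
    using order_R card_Pow[OF finite_max_ideals] unfolding order_def by simp
  also have "\<dots> \<le> (2 ^ p) ^ n" by (intro power_mono) (simp_all add: less_imp_le)
  also have "\<dots> = 2 ^ (p * n)" by (simp add: power_mult)
  finally show ?thesis by simp
qed

text \<open>The multiplicative group of the finite residue field is cyclic, and \<open>g\<close>
  lifts a generator; the zero residue is the case \<open>r \<in> m\<close>.\<close>

lemma residue_field_generator:
  assumes m: "m \<in> max_ideals"
  shows "\<exists>g\<in>carrier R. \<forall>r\<in>carrier R. r \<in> m \<or> (\<exists>k::nat. g [^] k \<ominus> r \<in> m)"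
proof -
  interpret m: maximalideal m R using m unfolding max_ideals_def by simp
  interpret Q: field "R Quot m" by (rule m.quotient_is_field) (rule is_cring)
  interpret h: ring_hom_cring R "R Quot m" "(+>) m"
    by (rule m.rcos_ring_hom_cring) (rule is_cring)
  have car: "carrier (R Quot m) = (+>) m ` carrier R"
    unfolding FactRing_def A_RCOSETS_def' by auto
  have zero: "\<zero>\<^bsub>R Quot m\<^esub> = m" unfolding FactRing_def by simp
  have "finite (carrier (R Quot m))" unfolding car by simp
  from Q.finite_field_mult_group_has_gen[OF this]
  obtain a where a: "a \<in> carrier (mult_of (R Quot m))"
    "carrier (mult_of (R Quot m)) = {a [^]\<^bsub>R Quot m\<^esub> i |i::nat. i \<in> UNIV}"
    unfolding nat_pow_mult_of by blast
  obtain g where g: "g \<in> carrier R" "a = m +> g" using a(1) car by auto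
  have "\<exists>k::nat. g [^] k \<ominus> r \<in> m" if r: "r \<in> carrier R" "r \<notin> m" for r
  proof -
    have "m +> r \<noteq> m" using r m.a_rcos_self by (metis)
    then have "m +> r \<in> carrier (mult_of (R Quot m))"
      using r zero car by simp
    then obtain k :: nat where "m +> r = a [^]\<^bsub>R Quot m\<^esub> k" using a(2) by auto
    moreover have "m +> g [^] k = a [^]\<^bsub>R Quot m\<^esub> k"
      by (induction k) (use g in simp_all)
    ultimately have "m +> g [^] k = m +> r" by simp
    then have "g [^] k \<ominus> r \<in> m"
      using quotient_eq_iff_same_a_r_cos[OF m.is_ideal] g(1) r(1) by simp
    then show ?thesis by blast
  qed
  then show ?thesis using g(1) by blast
qed

end

context finite_p_ring
begin

text \<open>A maximal ideal is identified by its row and column when the maximal ideals are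
  arranged in a square; the indicators of the rows and of the columns, together with a
  simultaneous lift \<open>g\<close> of generators of the residue fields, generate \<open>R\<close> modulo its
  nilradical.\<close>

lemma generators_mod_nilrad:
  "\<exists>G. finite G \<and> G \<subseteq> carrier R \<and> card G \<le> 2 * Suc (floor_sqrt (p * n)) + 1 \<and>
    (\<forall>L. asub L \<longrightarrow> \<one> \<in> L \<longrightarrow> (\<forall>x\<in>G. \<forall>u\<in>L. x \<otimes> u \<in> L) \<longrightarrow>
      (\<forall>r\<in>carrier R. \<exists>l\<in>L. r \<ominus> l \<in> nilrad))"
proof -
  \<comment> \<open>The successor makes the square strictly larger than the number of maximal
    ideals, so every row index is below \<open>s\<close>.\<close>
  define s where "s = Suc (floor_sqrt (p * n))"
  have s: "s > 0" unfolding s_def by simp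
  have "card max_ideals < s * s"
    using card_max_ideals Suc_floor_sqrt_power2_gt[of "p * n"] unfolding s_def power2_eq_square
    by linarith
  obtain idx :: "'a set \<Rightarrow> nat" where idx: "bij_betw idx max_ideals {0..<card max_ideals}"
    using ex_bij_betw_finite_nat[OF finite_max_ideals] by blast
  define row where "row m = idx m div s" for m
  define col where "col m = idx m mod s" for m
  have row: "row m < s" if "m \<in> max_ideals" for m
  proof -
    have "idx m < s * s"
      using bspec[OF bij_betwE[OF idx] that] \<open>card max_ideals < s * s\<close> by simp
    then show ?thesis unfolding row_def by (simp add: less_mult_imp_div_less)
  qed
  have col: "col m < s" for m unfolding col_def using s by simp
  have rc: "m = m'" if "m \<in> max_ideals" "m' \<in> max_ideals" "row m = row m'" "col m = col m'" for m m'
  proof -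
    have "idx m = idx m'"
      using that(3,4) div_mult_mod_eq unfolding row_def col_def by metis
    then show ?thesis using idx that(1,2) unfolding bij_betw_def inj_on_def by blast
  qed
  have "\<exists>r\<in>carrier R. \<forall>m\<in>max_ideals. r \<ominus> (if P m then \<one> else \<zero>) \<in> m" for P :: "'a set \<Rightarrow> bool"
    by (rule chinese_remainder) auto
  then obtain e where e: "\<And>P. e P \<in> carrier R"
    "\<And>P m. m \<in> max_ideals \<Longrightarrow> e P \<ominus> (if P m then \<one> else \<zero>) \<in> m" by metis
  define A where "A i = e (\<lambda>m. row m = i)" for i
  define B where "B i = e (\<lambda>m. col m = i)" for i
  have AR: "A i \<in> carrier R" and BR: "B i \<in> carrier R" for i
    unfolding A_def B_def using e(1) by auto
  have A1: "A (row m) \<ominus> \<one> \<in> m" and B1: "B (col m) \<ominus> \<one> \<in> m" if "m \<in> max_ideals" for m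
    using e(2)[OF that, of "\<lambda>m'. row m' = row m"] e(2)[OF that, of "\<lambda>m'. col m' = col m"]
    unfolding A_def B_def by auto
  have A0: "A i \<in> m" if "m \<in> max_ideals" "row m \<noteq> i" for m i
    using e(2)[OF that(1), of "\<lambda>m'. row m' = i"] that(2) AR[of i]
    unfolding A_def by (simp add: minus_eq)
  have B0: "B i \<in> m" if "m \<in> max_ideals" "col m \<noteq> i" for m i
    using e(2)[OF that(1), of "\<lambda>m'. col m' = i"] that(2) BR[of i]
    unfolding B_def by (simp add: minus_eq)
  obtain \<gamma> where \<gamma>: "\<And>m. m \<in> max_ideals \<Longrightarrow> \<gamma> m \<in> carrier R"
    "\<And>m r. m \<in> max_ideals \<Longrightarrow> r \<in> carrier R \<Longrightarrow> r \<in> m \<or> (\<exists>k::nat. \<gamma> m [^] k \<ominus> r \<in> m)"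
    using residue_field_generator by metis
  obtain g where g: "g \<in> carrier R" "\<And>m. m \<in> max_ideals \<Longrightarrow> g \<ominus> \<gamma> m \<in> m"
    using chinese_remainder[of \<gamma>] \<gamma>(1) by blast
  define G where "G = insert g (A ` {..<s} \<union> B ` {..<s})"
  have "card G \<le> Suc (card (A ` {..<s} \<union> B ` {..<s}))"
    unfolding G_def by (simp add: card_insert_if)
  also have "\<dots> \<le> Suc (card (A ` {..<s}) + card (B ` {..<s}))"
    using card_Un_le by simp
  also have "\<dots> \<le> 2 * s + 1"
    using card_image_le[of "{..<s}" A] card_image_le[of "{..<s}" B] by simp
  finally have cardG: "card G \<le> 2 * s + 1" .
  have approx: "\<exists>l\<in>L. r \<ominus> l \<in> nilrad"
    if L: "asub L" "\<one> \<in> L" "\<forall>x\<in>G. \<forall>u\<in>L. x \<otimes> u \<in> L" and r: "r \<in> carrier R" for L r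
  proof -
    have LR: "L \<subseteq> carrier R" using L(1) by (rule asub_subset)
    \<comment> \<open>\<open>L\<close> is not assumed closed under products. Monomials in
      \<open>G\<close> lie in it because they arise by acting on \<open>\<one>\<close>
      repeatedly.\<close>
    have gk: "g [^] k \<in> L" for k :: nat
    proof (induction k)
      case (Suc k)
      have "g \<otimes> g [^] k \<in> L" using L(3) Suc unfolding G_def by blast
      then show ?case using g(1) by (simp add: m_comm)
    qed (use L(2) in simp)
    \<comment> \<open>The approximation is kept zero at the ideals still to be treated, so each
      correction starts from residue 0 there.\<close>
    have "\<exists>l\<in>L. (\<forall>m\<in>F. r \<ominus> l \<in> m) \<and> (\<forall>m\<in>max_ideals - F. l \<in> m)" if "finite F" "F \<subseteq> max_ideals" for F
      using that
    proof (induction F rule: finite_induct)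
      case empty
      show ?case
        using asub_zero[OF L(1)] asub_zero[OF ideal_asub[OF max_ideals_ideal]]
        by (intro bexI[of _ \<zero>]) auto
    next
      case (insert m F)
      then obtain l where l: "l \<in> L" "\<forall>m\<in>F. r \<ominus> l \<in> m" "\<forall>m\<in>max_ideals - F. l \<in> m" by auto
      have lR: "l \<in> carrier R" using l LR by auto
      have m: "m \<in> max_ideals" "m \<notin> F" using insert by auto
      note I = max_ideals_ideal[OF m(1)]
      have lm: "l \<in> m" using l(3) m by blast
      show ?case
      proof (cases "r \<in> m")
        case True
        then have "r \<ominus> l \<in> m" using asub_minus[OF ideal_asub[OF I]] lm by blast
        then show ?thesis using l by (intro bexI[of _ l]) auto
      next
        case False
        then obtain k :: nat where k: "\<gamma> m [^] k \<ominus> r \<in> m" using \<gamma>(2)[OF m(1) r] by blast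
        \<comment> \<open>The two indicators multiply to 1 at \<open>m\<close> and to 0 at every
          other maximal ideal, as row and column together identify \<open>m\<close>; the power of
          \<open>g\<close> supplies the residue of \<open>r\<close>.\<close>
        let ?w = "A (row m) \<otimes> (B (col m) \<otimes> g [^] k)"
        have gR: "g [^] k \<in> carrier R" using g(1) by simp
        have wL: "?w \<in> L"
          using L(3) gk row[OF m(1)] col[of m] unfolding G_def by blast
        have wR: "?w \<in> carrier R" using wL LR by auto
        have "g [^] k \<ominus> \<gamma> m [^] k \<in> m" by (rule congr_pow[OF I g(1) \<gamma>(1) g(2)]) (use m in auto)
        then have gr: "g [^] k \<ominus> r \<in> m" using congr_trans[OF I gR _ r _ k] \<gamma>(1)[OF m(1)] by simp
        have "B (col m) \<otimes> g [^] k \<ominus> \<one> \<otimes> r \<in> m"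
          by (rule congr_mult[OF I BR one_closed gR r B1[OF m(1)] gr])
        then have "?w \<ominus> \<one> \<otimes> r \<in> m"
          using congr_mult[OF I AR one_closed _ r A1[OF m(1)], of "B (col m) \<otimes> g [^] k"] BR gR r
          by simp
        then have wr: "r \<ominus> ?w \<in> m" using congr_sym[OF I wR r] r by simp
        have w0: "?w \<in> m'" if m': "m' \<in> max_ideals" "m' \<noteq> m" for m'
        proof -
          have I': "ideal m' R" using m'(1) by (rule max_ideals_ideal)
          consider "row m' \<noteq> row m" | "col m' \<noteq> col m" using rc m m' by blast
          then show ?thesis
          proof cases
            case 1
            have "(B (col m) \<otimes> g [^] k) \<otimes> A (row m) \<in> m'"
              by (rule ideal_mult[OF I' A0[OF m'(1) 1]]) (use BR gR in simp)
            then show ?thesis using AR BR gR by (simp add: m_comm)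
          next
            case 2
            have "(A (row m) \<otimes> g [^] k) \<otimes> B (col m) \<in> m'"
              by (rule ideal_mult[OF I' B0[OF m'(1) 2]]) (use AR gR in simp)
            moreover have "(A (row m) \<otimes> g [^] k) \<otimes> B (col m) = ?w"
              using AR[of "row m"] BR[of "col m"] gR by algebra
            ultimately show ?thesis by simp
          qed
        qed
        show ?thesis
        proof (intro bexI[of _ "l \<oplus> ?w"] conjI ballI)
          show "l \<oplus> ?w \<in> L" by (rule asub_add[OF L(1) l(1) wL])
        next
          fix m' assume m': "m' \<in> insert m F"
          then have m'M: "m' \<in> max_ideals" using insert by auto
          note a' = ideal_asub[OF max_ideals_ideal[OF m'M]]
          show "r \<ominus> (l \<oplus> ?w) \<in> m'"
          proof (cases "m' = m")
            case True
            have "r \<ominus> (l \<oplus> ?w) = (r \<ominus> ?w) \<ominus> l" using r lR wR by algebra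
            then show ?thesis using asub_minus[OF a'] wr lm True by simp
          next
            case False
            have "r \<ominus> (l \<oplus> ?w) = (r \<ominus> l) \<ominus> ?w" using r lR wR by algebra
            then show ?thesis using asub_minus[OF a'] w0[OF m'M False] l(2) m' False by simp
          qed
        next
          fix m' assume "m' \<in> max_ideals - insert m F"
          then show "l \<oplus> ?w \<in> m'"
            using asub_add[OF ideal_asub[OF max_ideals_ideal]] l(3) w0 by blast
        qed
      qed
    qed
    from this[OF finite_max_ideals order_refl] obtain l where "l \<in> L" "\<forall>m\<in>max_ideals. r \<ominus> l \<in> m" by blast
    then show ?thesis using r LR unfolding nilrad_def by (intro bexI[of _ l]) auto
  qed
  have "finite G" "G \<subseteq> carrier R" unfolding G_def using AR BR g(1) by auto
  then show ?thesis using cardG approx unfolding s_def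
    by (intro exI[of _ G] conjI allI impI ballI)
qed

subsection \<open>Generation by few operators\<close>

text \<open>Multipliers are eliminated one by one. Products of \<open>J\<close> with the other
  elements of \<open>X\<close> are absorbed, together with \<open>N\<close>, into an
  \<open>x\<close>-stable subgroup \<open>P\<close>, leaving J contained in P + x J. Iteration gives
  P + x^k J = P, which is the hypothesis again for \<open>X\<close> without
  \<open>x\<close>.\<close>

lemma nakayama_nilpotent:
  assumes "finite X" "X \<subseteq> carrier R" "\<And>x. x \<in> X \<Longrightarrow> \<exists>k::nat. x [^] k = \<zero>"
    and N: "asub N" "\<And>x u. x \<in> X \<Longrightarrow> u \<in> N \<Longrightarrow> x \<otimes> u \<in> N"
    and J: "asub J" "\<And>x u. x \<in> X \<Longrightarrow> u \<in> J \<Longrightarrow> x \<otimes> u \<in> J"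
    and "\<And>L. asub L \<Longrightarrow> N \<subseteq> L \<Longrightarrow> \<forall>x\<in>X. \<forall>u\<in>J. x \<otimes> u \<in> L \<Longrightarrow> J \<subseteq> L"
  shows "J \<subseteq> N"
  using assms
proof (induction X rule: finite_induct)
  case empty
  then show ?case by simp
next
  case (insert x X)
  have xR: "x \<in> carrier R" and XR: "X \<subseteq> carrier R" using insert.prems(1) by auto
  have NR: "N \<subseteq> carrier R" and JR: "J \<subseteq> carrier R"
    using insert.prems(3,5) asub_subset by auto
  define S where "S = N \<union> {y \<otimes> u |y u. y \<in> X \<and> u \<in> J}"
  have SR: "S \<subseteq> carrier R" unfolding S_def using NR JR XR by auto
  define P where "P = add_span S"
  have P: "asub P" "S \<subseteq> P" unfolding P_def using asub_add_span[OF SR] add_span_superset by auto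
  have PR: "P \<subseteq> carrier R" by (rule asub_subset[OF P(1)])
  have xP: "x \<otimes> u \<in> P" if u: "u \<in> P" for u
  proof -
    have "S \<subseteq> {u \<in> P. x \<otimes> u \<in> P}"
    proof
      fix v assume v: "v \<in> S"
      then consider "v \<in> N" | y u where "y \<in> X" "u \<in> J" "v = y \<otimes> u"
        unfolding S_def by blast
      then have "x \<otimes> v \<in> S"
      proof cases
        case 1
        then show ?thesis using insert.prems(4) unfolding S_def by blast
      next
        case 2
        then have "x \<otimes> v = y \<otimes> (x \<otimes> u)" using xR XR JR m_lcomm by blast
        then show ?thesis using 2 insert.prems(6) unfolding S_def by blast
      qed
      then show "v \<in> {u \<in> P. x \<otimes> u \<in> P}" using v P(2) by blast
    qed
    then have "P \<subseteq> {u \<in> P. x \<otimes> u \<in> P}"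
      unfolding P_def by (intro add_span_least asub_preimage[OF xR]) (use P in \<open>auto simp: P_def\<close>)
    then show ?thesis using u by blast
  qed
  have xJ: "asub ((\<otimes>) x ` J)" by (rule asub_mult_image[OF xR insert.prems(5)])
  have "J \<subseteq> P <+>\<^bsub>R\<^esub> (\<otimes>) x ` J"
  proof (rule insert.prems(7))
    show "asub (P <+>\<^bsub>R\<^esub> (\<otimes>) x ` J)" by (rule asub_set_add[OF P(1) xJ])
    show "N \<subseteq> P <+>\<^bsub>R\<^esub> (\<otimes>) x ` J" using set_add_lower1[OF P(1) xJ] P(2) unfolding S_def by blast
    show "\<forall>x'\<in>insert x X. \<forall>u\<in>J. x' \<otimes> u \<in> P <+>\<^bsub>R\<^esub> (\<otimes>) x ` J"
      using set_add_lower1[OF P(1) xJ] set_add_lower2[OF P(1) xJ] P(2) unfolding S_def by blast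
  qed
  then have step: "\<exists>w\<in>P. \<exists>v\<in>J. u = w \<oplus> x \<otimes> v" if "u \<in> J" for u
    using that set_add_iff[of u P] by blast
  have iter: "\<exists>w\<in>P. \<exists>v\<in>J. u = w \<oplus> x [^] k \<otimes> v" if "u \<in> J" for u and k :: nat
    using that
  proof (induction k arbitrary: u)
    case 0
    then have "u = \<zero> \<oplus> x [^] (0::nat) \<otimes> u" using JR by auto
    then show ?case using asub_zero[OF P(1)] 0 by blast
  next
    case (Suc k)
    obtain w v where wv: "w \<in> P" "v \<in> J" "u = w \<oplus> x \<otimes> v" using step[OF Suc.prems] by blast
    obtain w' v' where wv': "w' \<in> P" "v' \<in> J" "v = w' \<oplus> x [^] k \<otimes> v'"
      using Suc.IH[OF wv(2)] by blast
    have c: "w \<in> carrier R" "v' \<in> carrier R" "w' \<in> carrier R" "x [^] k \<in> carrier R"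
      using wv wv' PR JR xR by auto
    have "u = (w \<oplus> x \<otimes> w') \<oplus> x [^] Suc k \<otimes> v'"
      unfolding wv(3) wv'(3) nat_pow_Suc using c xR by algebra
    moreover have "w \<oplus> x \<otimes> w' \<in> P" using asub_add[OF P(1) wv(1) xP[OF wv'(1)]] .
    ultimately show ?case using wv'(2) by blast
  qed
  obtain k :: nat where k: "x [^] k = \<zero>" using insert.prems(2)[of x] by blast
  have JP: "J \<subseteq> P"
  proof
    fix u assume "u \<in> J"
    from iter[OF this, of k] obtain w v where wv: "w \<in> P" "v \<in> J" "u = w \<oplus> x [^] k \<otimes> v" by blast
    then have "w \<in> carrier R" "v \<in> carrier R" using PR JR by auto
    then show "u \<in> P" using wv k by simp
  qed
  show ?case
  proof (rule insert.IH)
    fix L assume L: "asub L" "N \<subseteq> L" "\<forall>x\<in>X. \<forall>u\<in>J. x \<otimes> u \<in> L"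
    then have "P \<subseteq> L" unfolding P_def S_def by (intro add_span_least) auto
    then show "J \<subseteq> L" using JP by blast
  qed (use insert.prems in auto)
qed

lemma sparse_generation:
  "\<exists>M V X. asub M \<and> finite V \<and> V \<subseteq> carrier R \<and> card V + logcard M \<le> n \<and>
    (\<forall>v\<in>V. \<forall>w\<in>V. v \<otimes> w \<in> M) \<and>
    finite X \<and> X \<subseteq> carrier R \<and>
    card X \<le> 5 * floor_sqrt n + 2 * Suc (floor_sqrt (p * n)) + 1 \<and>
    (\<forall>N. asub N \<longrightarrow> \<one> \<in> N \<longrightarrow> V \<subseteq> N \<longrightarrow> (\<forall>x\<in>X. \<forall>u\<in>N. x \<otimes> u \<in> N) \<longrightarrow> N = carrier R)"
proof -
  let ?J = nilrad
  have JR: "?J \<subseteq> carrier R" by (rule asub_subset[OF asub_nilrad])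
  define S where "S = {u \<otimes> v |u v. u \<in> ?J \<and> v \<in> ?J}"
  have SR: "S \<subseteq> carrier R" unfolding S_def using JR by auto
  define M where "M = add_span S"
  have M: "asub M" "S \<subseteq> M" unfolding M_def using asub_add_span[OF SR] add_span_superset by auto
  have MJ: "M \<subseteq> ?J"
    unfolding M_def by (rule add_span_least[OF asub_nilrad]) (use nilrad_mult JR in \<open>auto simp: S_def\<close>)
  obtain V where V: "finite V" "V \<subseteq> ?J" "card V \<le> logcard ?J - logcard M"
    "\<forall>L. asub L \<longrightarrow> M \<subseteq> L \<longrightarrow> V \<subseteq> L \<longrightarrow> ?J \<subseteq> L"
    using relative_generators[OF M(1) asub_nilrad MJ] by blast
  obtain X where X: "finite X" "X \<subseteq> ?J" "card X \<le> 5 * floor_sqrt n"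
    "\<forall>L. asub L \<longrightarrow> (\<forall>x\<in>X. \<forall>u\<in>?J. x \<otimes> u \<in> L) \<longrightarrow> (\<forall>y\<in>?J. \<forall>k\<in>?J. y \<otimes> k \<in> L)"
    using few_multipliers[OF asub_nilrad] by blast
  obtain G where G: "finite G" "G \<subseteq> carrier R" "card G \<le> 2 * Suc (floor_sqrt (p * n)) + 1"
    "\<forall>L. asub L \<longrightarrow> \<one> \<in> L \<longrightarrow> (\<forall>x\<in>G. \<forall>u\<in>L. x \<otimes> u \<in> L) \<longrightarrow>
      (\<forall>r\<in>carrier R. \<exists>l\<in>L. r \<ominus> l \<in> ?J)"
    using generators_mod_nilrad by blast
  have gen: "N = carrier R"
    if N: "asub N" "\<one> \<in> N" "V \<subseteq> N" "\<forall>x\<in>X \<union> G. \<forall>u\<in>N. x \<otimes> u \<in> N" for N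
  proof
    show NR: "N \<subseteq> carrier R" by (rule asub_subset[OF N(1)])
    have JN: "?J \<subseteq> N"
    proof (rule nakayama_nilpotent[OF X(1) _ _ N(1) _ asub_nilrad])
      \<comment> \<open>Here the few multipliers pay off: a subgroup containing x J for the chosen x
        contains all of J J, hence \<open>M\<close>, so generation modulo \<open>M\<close> yields
        the Nakayama hypothesis.\<close>
      fix L assume L: "asub L" "N \<subseteq> L" "\<forall>x\<in>X. \<forall>u\<in>?J. x \<otimes> u \<in> L"
      then have "S \<subseteq> L" using X(4) unfolding S_def by blast
      then have "M \<subseteq> L" unfolding M_def using add_span_least L(1) by blast
      then show "?J \<subseteq> L" using V(4) L N(3) by blast
    qed (use X JR N nilrad_nilpotent nilrad_mult in auto)
    show "carrier R \<subseteq> N"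
    proof
      fix r assume r: "r \<in> carrier R"
      have "\<exists>l\<in>N. r \<ominus> l \<in> ?J" using G(4) N r by blast
      then obtain l where l: "l \<in> N" "r \<ominus> l \<in> ?J" by blast
      then have "l \<oplus> (r \<ominus> l) \<in> N" using asub_add[OF N(1)] JN by blast
      moreover have "l \<in> carrier R" using l NR by auto
      then have "l \<oplus> (r \<ominus> l) = r" using r by algebra
      ultimately show "r \<in> N" by simp
    qed
  qed
  have "card (X \<union> G) \<le> 5 * floor_sqrt n + 2 * Suc (floor_sqrt (p * n)) + 1"
    using card_Un_le[of X G] X(3) G(3) by linarith
  moreover have "card V + logcard M \<le> n"
    using V(3) logcard_mono[OF M(1) asub_nilrad MJ] logcard_le[OF asub_nilrad] by linarith
  moreover have "\<forall>v\<in>V. \<forall>w\<in>V. v \<otimes> w \<in> M" using M(2) V(2) unfolding S_def by blast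
  moreover have "V \<subseteq> carrier R" "X \<union> G \<subseteq> carrier R" "finite (X \<union> G)"
    using V(2) X(1,2) G(1,2) JR by auto
  ultimately show ?thesis
    using M(1) V(1) gen
    by (intro exI[of _ M] exI[of _ V] exI[of _ "X \<union> G"] conjI allI impI)
qed

end

subsection \<open>Digit expansions\<close>

text \<open>Integer coefficients make this additive in the coefficients; residues modulo p would
  not, since y j may have additive order above p. Coefficients in \<open>digits\<close> are the
  normal forms.\<close>

primrec lincomb :: "('a, 'b) ring_scheme \<Rightarrow> (nat \<Rightarrow> 'a) \<Rightarrow> (nat \<Rightarrow> int) \<Rightarrow> nat \<Rightarrow> 'a" where
  "lincomb R y a 0 = \<zero>\<^bsub>R\<^esub>"
| "lincomb R y a (Suc k) = lincomb R y a k \<oplus>\<^bsub>R\<^esub> [a k] \<cdot>\<^bsub>R\<^esub> y k"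

abbreviation digits :: "nat \<Rightarrow> nat \<Rightarrow> (nat \<Rightarrow> int) set"
  where "digits p k \<equiv> {..<k} \<rightarrow>\<^sub>E {0..<int p}"

lemma lincomb_cong:
  "(\<And>j. j < k \<Longrightarrow> a j = b j) \<Longrightarrow> (\<And>j. j < k \<Longrightarrow> y j = z j) \<Longrightarrow> lincomb R y a k = lincomb R z b k"
  by (induction k) auto

context ring
begin

lemma add_pow_int_0 [simp]: "[(0::int)] \<cdot> x = \<zero>"
  by (simp add: add_pow_def)

lemma lincomb_closed: "(\<And>j. j < k \<Longrightarrow> y j \<in> carrier R) \<Longrightarrow> lincomb R y a k \<in> carrier R"
  by (induction k) auto

lemma lincomb_zero: "(\<And>j. j < k \<Longrightarrow> a j = 0) \<Longrightarrow> (\<And>j. j < k \<Longrightarrow> y j \<in> carrier R) \<Longrightarrow>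
    lincomb R y a k = \<zero>"
  by (induction k) auto

lemma lincomb_add:
  "(\<And>j. j < k \<Longrightarrow> y j \<in> carrier R) \<Longrightarrow>
    lincomb R y (\<lambda>j. a j + b j) k = lincomb R y a k \<oplus> lincomb R y b k"
proof (induction k)
  case (Suc k)
  have y: "y k \<in> carrier R" "\<And>j. j < k \<Longrightarrow> y j \<in> carrier R" using Suc.prems by auto
  have "[(a k + b k)] \<cdot> y k = [a k] \<cdot> y k \<oplus> [b k] \<cdot> y k"
    using add.int_pow_mult[OF y(1)] by simp
  then show ?case
    using Suc.IH y lincomb_closed[OF y(2)] by (simp add: a_ac)
qed simp

lemma lincomb_scale:
  "(\<And>j. j < k \<Longrightarrow> y j \<in> carrier R) \<Longrightarrow>
    lincomb R y (\<lambda>j. i * a j) k = [i] \<cdot> lincomb R y a k"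
proof (induction k)
  case (Suc k)
  have y: "y k \<in> carrier R" "\<And>j. j < k \<Longrightarrow> y j \<in> carrier R" using Suc.prems by auto
  have "[(i * a k)] \<cdot> y k = [i] \<cdot> ([a k] \<cdot> y k)"
    using add.int_pow_pow[OF y(1)] by (simp add: mult.commute)
  then show ?case
    using Suc.IH y lincomb_closed[OF y(2)] by (simp add: add.int_pow_distrib)
qed simp

lemma lincomb_minus:
  assumes "\<And>j. j < k \<Longrightarrow> y j \<in> carrier R"
  shows "lincomb R y (\<lambda>j. a j - b j) k = lincomb R y a k \<ominus> lincomb R y b k"
proof -
  have "lincomb R y a k = lincomb R y (\<lambda>j. a j - b j) k \<oplus> lincomb R y b k"
    using lincomb_add[OF assms, where a = "\<lambda>j. a j - b j" and b = b] by simp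
  then show ?thesis
    using lincomb_closed[OF assms] by (simp add: minus_eq a_assoc r_neg)
qed

lemma lincomb_mult:
  assumes "x \<in> carrier R"
  shows "(\<And>j. j < k \<Longrightarrow> y j \<in> carrier R) \<Longrightarrow>
    x \<otimes> lincomb R y a k = lincomb R (\<lambda>j. x \<otimes> y j) a k"
proof (induction k)
  case (Suc k)
  have y: "y k \<in> carrier R" "\<And>j. j < k \<Longrightarrow> y j \<in> carrier R" using Suc.prems by auto
  then show ?case
    using Suc.IH assms lincomb_closed[OF y(2)] by (simp add: r_distr add_pow_rdistr_int)
qed (use assms in simp)

text \<open>The carry of base q arithmetic: the quotient of the leading coefficient moves to lower
  positions through the relation for \<open>[q] \<cdot> y k\<close>.\<close>

lemma lincomb_carry:
  assumes "\<And>j. j < Suc k \<Longrightarrow> y j \<in> carrier R" "[q] \<cdot> y k = lincomb R y c k"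
  shows "lincomb R y a (Suc k) =
    lincomb R y (\<lambda>j. a j + (a k div q) * c j) k \<oplus> [(a k mod q)] \<cdot> y k"
proof -
  have y: "y k \<in> carrier R" "\<And>j. j < k \<Longrightarrow> y j \<in> carrier R" using assms by auto
  have "[a k] \<cdot> y k = [(q * (a k div q) + a k mod q)] \<cdot> y k" by simp
  also have "\<dots> = [(q * (a k div q))] \<cdot> y k \<oplus> [(a k mod q)] \<cdot> y k"
    using add.int_pow_mult[OF y(1)] by blast
  also have "[(q * (a k div q))] \<cdot> y k = [(a k div q)] \<cdot> lincomb R y c k"
    using add.int_pow_pow[OF y(1)] assms(2) by metis
  finally have "[a k] \<cdot> y k = [(a k div q)] \<cdot> lincomb R y c k \<oplus> [(a k mod q)] \<cdot> y k" .
  then show ?thesis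
    using y lincomb_closed[OF y(2)]
    by (simp add: lincomb_add[OF y(2)] lincomb_scale[OF y(2)] a_assoc)
qed

end

section \<open>Triangular bases of additive subgroups\<close>

context finite_p_ring
begin

text \<open>A polycyclic presentation: initial segments span a chain of subgroups with steps of
  index p. Unlike a decomposition into cyclic summands, it always extends from a subgroup to a
  larger one.\<close>

definition p_basis :: "(nat \<Rightarrow> 'a) \<Rightarrow> nat \<Rightarrow> 'a set \<Rightarrow> bool" where
  "p_basis y k H \<longleftrightarrow> asub H \<and> card H = p ^ k \<and> (\<forall>j<k. y j \<in> carrier R) \<and>
    (\<lambda>d. lincomb R y d k) ` digits p k = H \<and>
    (\<forall>j<k. \<exists>d. (\<forall>i<j. d i \<in> {0..<int p}) \<and> [int p] \<cdot> y j = lincomb R y d j)"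

lemma p_basis_cong:
  assumes "\<And>j. j < k \<Longrightarrow> y j = z j"
  shows "p_basis y k H \<longleftrightarrow> p_basis z k H"
proof -
  have "lincomb R y d j = lincomb R z d j" if "j \<le> k" for d j
    by (rule lincomb_cong) (use assms that in auto)
  then show ?thesis using assms unfolding p_basis_def by auto
qed

lemma p_basis_zero: "p_basis y 0 {\<zero>}"
  unfolding p_basis_def using asub_singleton_zero by auto

text \<open>Among w, p w, p^2 w, ... take the last term before the sequence enters
  \<open>H\<close>.\<close>

lemma p_socle_element:
  assumes "asub H" "asub K" "H \<subset> K"
  shows "\<exists>z\<in>K. z \<notin> H \<and> [int p] \<cdot> z \<in> H"
proof -
  obtain w where w: "w \<in> K" "w \<notin> H" using assms by auto
  have wR: "w \<in> carrier R" using w assms asub_subset by auto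
  have "[(p ^ n)] \<cdot> w = \<zero>"
    using add.pow_order_eq_1[of w] wR order_R unfolding order_def by simp
  then have ex: "[(p ^ n)] \<cdot> w \<in> H" using asub_zero assms by simp
  define i where "i = (LEAST i. [(p ^ i)] \<cdot> w \<in> H)"
  have i: "[(p ^ i)] \<cdot> w \<in> H" unfolding i_def using ex by (rule LeastI)
  have "i \<noteq> 0" using i w wR by (cases "i = 0") auto
  then obtain k where k: "i = Suc k" by (cases i) auto
  have "[(p ^ k)] \<cdot> w \<notin> H" using k unfolding i_def by (intro not_less_Least) simp
  moreover have "[(p ^ k)] \<cdot> w \<in> K" using asub_nat_mult[OF assms(2) w(1)] .
  moreover have "[int p] \<cdot> ([(p ^ k)] \<cdot> w) = [(p ^ i)] \<cdot> w"
    using k add.nat_pow_pow[OF wR] by (simp add: add_pow_int_ge mult.commute)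
  ultimately show ?thesis using i by metis
qed

lemma p_basis_Suc:
  assumes H: "p_basis y k H" and z: "z \<in> carrier R" "z \<notin> H" "[int p] \<cdot> z \<in> H"
  defines "H' \<equiv> {h \<oplus> [i] \<cdot> z |h i. h \<in> H \<and> i \<in> (UNIV :: int set)}"
  shows "p_basis (y(k := z)) (Suc k) H'"
proof -
  let ?y = "y(k := z)"
  have a: "asub H" and cH: "card H = p ^ k" and y: "\<And>j. j < k \<Longrightarrow> y j \<in> carrier R"
    and im: "(\<lambda>d. lincomb R y d k) ` digits p k = H"
    and rel: "\<forall>j<k. \<exists>d. (\<forall>i<j. d i \<in> {0..<int p}) \<and> [int p] \<cdot> y j = lincomb R y d j"
    using H unfolding p_basis_def by auto
  have HR: "H \<subseteq> carrier R" by (rule asub_subset[OF a])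
  have H'I: "h \<oplus> [i] \<cdot> z \<in> H'" if "h \<in> H" for h and i :: int
    unfolding H'_def using that by blast
  have aH': "asub H'"
  proof (rule asubI)
    show "H' \<subseteq> carrier R" unfolding H'_def using HR z by auto
    show "\<zero> \<in> H'" using H'I[OF asub_zero[OF a], of 0] z by simp
    fix u w assume "u \<in> H'" "w \<in> H'"
    then obtain h i h' i' where uw: "h \<in> H" "h' \<in> H" "u = h \<oplus> [(i::int)] \<cdot> z" "w = h' \<oplus> [(i'::int)] \<cdot> z"
      unfolding H'_def by auto
    have c: "h \<in> carrier R" "h' \<in> carrier R" "[i] \<cdot> z \<in> carrier R" "[i'] \<cdot> z \<in> carrier R"
      using uw HR z by auto
    have "[(i - i')] \<cdot> z \<oplus> [i'] \<cdot> z = [i] \<cdot> z"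
      using add.int_pow_mult[OF z(1), of "i - i'" i'] by simp
    then have "[(i - i')] \<cdot> z = [i] \<cdot> z \<ominus> [i'] \<cdot> z"
      using c z by (metis add.int_pow_closed add.inv_solve_right minus_eq)
    then have "u \<ominus> w = (h \<ominus> h') \<oplus> [(i - i')] \<cdot> z" unfolding uw using c by algebra
    then show "u \<ominus> w \<in> H'" using H'I asub_minus[OF a] uw by simp
  qed
  have low: "lincomb R ?y d k = lincomb R y d k" for d by (rule lincomb_cong) auto
  have img: "(\<lambda>d. lincomb R ?y d (Suc k)) ` digits p (Suc k) = H'"
  proof
    show "(\<lambda>d. lincomb R ?y d (Suc k)) ` digits p (Suc k) \<subseteq> H'"
    proof (rule image_subsetI)
      fix d assume d: "d \<in> digits p (Suc k)"
      have "lincomb R y d k = lincomb R y (restrict d {..<k}) k" by (rule lincomb_cong) auto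
      moreover have "restrict d {..<k} \<in> digits p k" using d by (auto simp: PiE_def Pi_def)
      ultimately have "lincomb R y d k \<in> H" using im by auto
      then show "lincomb R ?y d (Suc k) \<in> H'" using H'I low by simp
    qed
    show "H' \<subseteq> (\<lambda>d. lincomb R ?y d (Suc k)) ` digits p (Suc k)"
    proof
      fix u assume "u \<in> H'"
      then obtain h i where u: "h \<in> H" "u = h \<oplus> [(i::int)] \<cdot> z" unfolding H'_def by auto
      have c: "h \<in> carrier R" using u HR by auto
      let ?q = "i div int p" and ?r = "i mod int p"
      have "[i] \<cdot> z = [(int p * ?q)] \<cdot> z \<oplus> [?r] \<cdot> z"
        using add.int_pow_mult[OF z(1), of "int p * ?q" ?r] by simp
      moreover have "[(int p * ?q)] \<cdot> z = [?q] \<cdot> ([int p] \<cdot> z)"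
        using add.int_pow_pow[OF z(1)] by metis
      ultimately have "u = (h \<oplus> [?q] \<cdot> ([int p] \<cdot> z)) \<oplus> [?r] \<cdot> z"
        unfolding u using c z by (simp add: a_assoc)
      moreover have "h \<oplus> [?q] \<cdot> ([int p] \<cdot> z) \<in> H"
        using asub_add[OF a u(1) asub_int_mult[OF a z(3)]] .
      then obtain d where d: "d \<in> digits p k" "h \<oplus> [?q] \<cdot> ([int p] \<cdot> z) = lincomb R y d k"
        using im by blast
      moreover have "lincomb R ?y (d(k := ?r)) k = lincomb R y d k"
        by (rule lincomb_cong) auto
      ultimately have "u = lincomb R ?y (d(k := ?r)) (Suc k)" by simp
      moreover have "d(k := ?r) \<in> digits p (Suc k)"
        using PiE_fun_upd[of ?r "\<lambda>_. {0..<int p}" k d "{..<k}"] d(1) p_gt_1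
        by (simp add: lessThan_Suc)
      ultimately show "u \<in> (\<lambda>d. lincomb R ?y d (Suc k)) ` digits p (Suc k)" by blast
    qed
  qed
  \<comment> \<open>The order of \<open>H'\<close> is squeezed: digits cover it, so it is at most
    p^(k+1), and as a power of p above p^k it is no smaller.\<close>
  have "card H' \<le> card (digits p (Suc k))"
    unfolding img[symmetric] by (intro card_image_le finite_PiE) auto
  also have "\<dots> = p ^ Suc k" by (simp add: card_PiE)
  finally have le: "card H' \<le> p ^ Suc k" .
  have sub: "H \<subset> H'"
  proof
    show "H \<subseteq> H'" using H'I[of _ 0] HR by force
    have "z \<in> H'" using H'I[OF asub_zero[OF a], of 1] z by simp
    then show "H \<noteq> H'" using z by blast
  qed
  have "p ^ logcard H' \<le> p ^ Suc k" using le card_asub[OF aH'] by simp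
  then have "logcard H' \<le> Suc k" using p_gt_1 power_le_imp_le_exp by blast
  moreover have "k < logcard H'"
    using logcard_strict_mono[OF a aH' sub] cH card_asub[OF a] p_gt_1 by simp
  ultimately have "logcard H' = Suc k" by simp
  then have "card H' = p ^ Suc k" using card_asub[OF aH'] by simp
  moreover have "\<exists>d. (\<forall>i<j. d i \<in> {0..<int p}) \<and> [int p] \<cdot> ?y j = lincomb R ?y d j"
    if "j < Suc k" for j
  proof (cases "j = k")
    case True
    obtain d where "d \<in> digits p k" "[int p] \<cdot> z = lincomb R y d k" using z(3) im by blast
    then show ?thesis using True low by (intro exI[of _ d]) auto
  next
    case False
    then have "j < k" using that by simp
    then obtain d where d: "\<forall>i<j. d i \<in> {0..<int p}" "[int p] \<cdot> y j = lincomb R y d j"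
      using rel by blast
    moreover have "lincomb R ?y d j = lincomb R y d j"
      by (rule lincomb_cong) (use \<open>j < k\<close> in auto)
    ultimately show ?thesis using False by (intro exI[of _ d]) auto
  qed
  ultimately show ?thesis
    using aH' y z img unfolding p_basis_def by (auto simp: less_Suc_eq)
qed

lemma p_basis_extend:
  assumes "p_basis y k H" "asub K" "H \<subseteq> K"
  shows "\<exists>y'. (\<forall>j<k. y' j = y j) \<and> p_basis y' (logcard K) K"
  using assms
proof (induction "logcard K - k" arbitrary: y k H rule: less_induct)
  case less
  have a: "asub H" and cH: "card H = p ^ k" using less.prems(1) unfolding p_basis_def by auto
  have k: "k = logcard H" using cH card_asub[OF a] p_gt_1 by simp
  show ?case
  proof (cases "H = K")
    case True
    then show ?thesis using less.prems k by blast
  next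
    case False
    then obtain z where z: "z \<in> K" "z \<notin> H" "[int p] \<cdot> z \<in> H"
      using p_socle_element[OF a less.prems(2)] less.prems(3) by blast
    define H' where "H' = {h \<oplus> [i] \<cdot> z |h i. h \<in> H \<and> i \<in> (UNIV :: int set)}"
    have zR: "z \<in> carrier R" using z less.prems asub_subset by blast
    have pb: "p_basis (y(k := z)) (Suc k) H'"
      unfolding H'_def by (rule p_basis_Suc[OF less.prems(1) zR z(2,3)])
    have H'K: "H' \<subseteq> K"
      unfolding H'_def using asub_add[OF less.prems(2)] asub_int_mult[OF less.prems(2)] z less.prems(3)
      by blast
    have "H \<subset> K" using False less.prems(3) by blast
    then have "logcard K - Suc k < logcard K - k"
      using logcard_strict_mono[OF a less.prems(2)] k by simp
    from less.hyps[OF this pb less.prems(2) H'K] obtain y'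
      where y': "\<forall>j<Suc k. y' j = (y(k := z)) j" "p_basis y' (logcard K) K" by blast
    then show ?thesis by (intro exI[of _ y']) auto
  qed
qed

text \<open>The same \<open>y\<close> serves both groups, its first \<open>logcard M\<close> members
  spanning \<open>M\<close>; this is what lets a product in \<open>M\<close> be stored with fewer
  than n digits when \<open>M\<close> is small.\<close>

lemma adapted_p_basis:
  assumes "asub M"
  shows "\<exists>y. p_basis y (logcard M) M \<and> p_basis y n (carrier R)"
proof -
  have "{\<zero>} \<subseteq> M" using asub_zero[OF assms] by simp
  then obtain y where y: "p_basis y (logcard M) M"
    using p_basis_extend[OF p_basis_zero assms, of undefined] by auto
  obtain y' where "\<forall>j<logcard M. y' j = y j" "p_basis y' n (carrier R)"
    using p_basis_extend[OF y asub_carrier asub_subset[OF assms]] logcard_carrier by auto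
  then show ?thesis using y p_basis_cong[of "logcard M" y y' M] by auto
qed

end

subsection \<open>Codes of rings\<close>

text \<open>Positions of the independent coefficients of a symmetric bilinear map from rank
  \<open>a\<close> to rank \<open>b\<close>; both bounds count functions on such a set.\<close>

definition triples :: "nat \<Rightarrow> nat \<Rightarrow> (nat \<times> nat \<times> nat) set"
  where "triples a b = (SIGMA i:{..<a}. {i..<a} \<times> {..<b})"

lemma finite_triples: "finite (triples a b)"
  unfolding triples_def by auto

lemma card_triples: "2 * card (triples a b) = a * (a + 1) * b"
proof -
  have s: "2 * (\<Sum>i<a. a - i) = a * (a + 1)"
  proof (induction a)
    case (Suc a)
    have "(\<Sum>i<Suc a. Suc a - i) = (\<Sum>i<a. Suc (a - i)) + 1"
      by (simp add: Suc_diff_le)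
    also have "\<dots> = (\<Sum>i<a. a - i) + a + 1" by (simp only: Suc_eq_plus1 sum.distrib sum_constant card_lessThan) simp
    finally show ?case using Suc by simp
  qed simp
  have "card (triples a b) = (\<Sum>i<a. a - i) * b"
    unfolding triples_def by (simp add: card_SigmaI sum_distrib_right)
  then show ?thesis using s by (metis mult.assoc)
qed

text \<open>A code consists of the rank \<open>c\<close> of a subgroup \<open>M\<close> and of the digits, with respect to a
  basis \<open>y\<close> adapted to \<open>M\<close>, of the elements \<open>p y\<^sub>j\<close>, \<open>v\<^sub>i\<close>, \<open>1\<close> and \<open>x\<^sub>i y\<^sub>j\<close> (in \<open>B\<close>) and
  of \<open>v\<^sub>i v\<^sub>j \<in> M\<close> (in \<open>P\<close>); the products \<open>v\<^sub>i v\<^sub>j\<close> need only \<open>c\<close> digits each.\<close>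

definition coded :: "'a ring \<Rightarrow> nat \<Rightarrow> nat \<Rightarrow> nat \<Rightarrow>
    nat \<Rightarrow> (nat \<times> nat \<times> nat \<Rightarrow> int) \<Rightarrow> (nat \<times> nat \<times> nat \<Rightarrow> int) \<Rightarrow> bool" where
  "coded R p n s c B P \<longleftrightarrow> (\<exists>y v x.
    (\<forall>j<n. y j \<in> carrier R \<and> [int p] \<cdot>\<^bsub>R\<^esub> y j = lincomb R y (\<lambda>k. B (0, j, k)) j) \<and>
    bij_betw (\<lambda>d. lincomb R y d n) (digits p n) (carrier R) \<and>
    (\<forall>i<n - c. v i = lincomb R y (\<lambda>k. B (1, i, k)) n) \<and>
    \<one>\<^bsub>R\<^esub> = lincomb R y (\<lambda>k. B (2, 0, k)) n \<and>
    (\<forall>i<s. x i \<in> carrier R \<and>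
      (\<forall>j<n. x i \<otimes>\<^bsub>R\<^esub> y j = lincomb R y (\<lambda>k. B (3 + i, j, k)) n)) \<and>
    (\<forall>j<n - c. \<forall>i\<le>j. v i \<otimes>\<^bsub>R\<^esub> v j = lincomb R y (\<lambda>k. P (i, j, k)) c) \<and>
    (\<forall>N. additive_subgroup N R \<longrightarrow> \<one>\<^bsub>R\<^esub> \<in> N \<longrightarrow> (\<forall>i<n - c. v i \<in> N) \<longrightarrow>
      (\<forall>i<s. \<forall>u\<in>N. x i \<otimes>\<^bsub>R\<^esub> u \<in> N) \<longrightarrow> N = carrier R))"

text \<open>The number \<open>c\<close> belongs to the code because it fixes the shape of
  \<open>P\<close>. The box for \<open>B\<close> has three layers for p y_j, v_i and 1 and one for
  each of the \<open>s\<close> operators, at n^2 digits per layer.\<close>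

definition codes :: "nat \<Rightarrow> nat \<Rightarrow> nat \<Rightarrow>
    (nat \<times> (nat \<times> nat \<times> nat \<Rightarrow> int) \<times> (nat \<times> nat \<times> nat \<Rightarrow> int)) set" where
  "codes p n s = (SIGMA c:{..n}. (({..<s + 3} \<times> {..<n} \<times> {..<n}) \<rightarrow>\<^sub>E {0..<int p}) \<times>
    (triples (n - c) c \<rightarrow>\<^sub>E {0..<int p}))"

text \<open>Padding with a default element gives lists of prescribed length, so a code need not
  record the sizes of the generating sets.\<close>

lemma finite_enumeration_padded:
  assumes "finite V" "card V \<le> k"
  shows "\<exists>v::nat \<Rightarrow> 'a. V \<subseteq> v ` {..<k} \<and> (\<forall>i. v i \<in> insert z V)"
proof -
  obtain f where f: "bij_betw f {0..<card V} V"
    using ex_bij_betw_nat_finite[OF assms(1)] by blast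
  define v where "v i = (if i < card V then f i else z)" for i
  have "V \<subseteq> v ` {..<k}"
  proof
    fix u assume "u \<in> V"
    then obtain i where "i < card V" "u = f i"
      using bij_betw_imp_surj_on[OF f] by (metis atLeastLessThan_iff imageE)
    then show "u \<in> v ` {..<k}" using assms(2) unfolding v_def by (intro image_eqI[of _ _ i]) auto
  qed
  moreover have "v i \<in> insert z V" for i
    using bij_betwE[OF f] unfolding v_def by auto
  ultimately show ?thesis by blast
qed

context finite_p_ring
begin

lemma p_basis_bij:
  assumes "p_basis y k H"
  shows "bij_betw (\<lambda>d. lincomb R y d k) (digits p k) H"
proof -
  have im: "(\<lambda>d. lincomb R y d k) ` digits p k = H" and "card H = p ^ k"
    using assms unfolding p_basis_def by auto
  then have "card ((\<lambda>d. lincomb R y d k) ` digits p k) = card (digits p k)"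
    by (simp add: card_PiE)
  then show ?thesis
    unfolding bij_betw_def using im by (intro conjI eq_card_imp_inj_on finite_PiE) auto
qed

end

lemma coded_exists:
  fixes R :: "'a ring" (structure)
  assumes "cring R" "order R = p ^ n" "Factorial_Ring.prime p" "n \<ge> 1"
    and s: "s = 5 * floor_sqrt n + 2 * Suc (floor_sqrt (p * n)) + 1"
  shows "\<exists>c B P. (c, B, P) \<in> codes p n s \<and> coded R p n s c B P"
proof -
  interpret finite_p_ring R p n
    using assms by (simp add: finite_p_ring_def finite_p_ring_axioms_def)
  obtain M V X where M: "asub M" and V: "finite V" "V \<subseteq> carrier R" "card V + logcard M \<le> n"
    "\<forall>v\<in>V. \<forall>w\<in>V. v \<otimes> w \<in> M" and X: "finite X" "X \<subseteq> carrier R" "card X \<le> s"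
    and gen: "\<forall>N. asub N \<longrightarrow> \<one> \<in> N \<longrightarrow> V \<subseteq> N \<longrightarrow> (\<forall>x\<in>X. \<forall>u\<in>N. x \<otimes> u \<in> N) \<longrightarrow> N = carrier R"
    using sparse_generation s by blast
  define c where "c = logcard M"
  have c: "c \<le> n" unfolding c_def using V(3) by simp
  have "card V \<le> n - c" using V(3) unfolding c_def by simp
  then obtain v where v: "V \<subseteq> v ` {..<n - c}" "\<forall>i. v i \<in> insert \<zero> V"
    using finite_enumeration_padded[OF V(1)] by blast
  obtain x where x: "X \<subseteq> x ` {..<s}" "\<forall>i. x i \<in> insert \<zero> X"
    using finite_enumeration_padded[OF X(1,3)] by blast
  have vR: "v i \<in> carrier R" for i using v(2)[rule_format, of i] V(2) by auto
  have xR: "x i \<in> carrier R" for i using x(2)[rule_format, of i] X(2) by auto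
  have vv: "v i \<otimes> v j \<in> M" for i j
    using v(2)[rule_format, of i] v(2)[rule_format, of j] V(2,4) asub_zero[OF M] by auto
  obtain y where y: "p_basis y c M" "p_basis y n (carrier R)"
    using adapted_p_basis[OF M] unfolding c_def by blast
  have yR: "y j \<in> carrier R" if "j < n" for j using y(2) that unfolding p_basis_def by blast
  have bij: "bij_betw (\<lambda>d. lincomb R y d n) (digits p n) (carrier R)"
    by (rule p_basis_bij[OF y(2)])
  have "\<forall>j. \<exists>d. j < n \<longrightarrow> (\<forall>i<j. d i \<in> {0..<int p}) \<and> [int p] \<cdot> y j = lincomb R y d j"
    using y(2) unfolding p_basis_def by blast
  then obtain r where r: "\<And>j i. j < n \<Longrightarrow> i < j \<Longrightarrow> r j i \<in> {0..<int p}"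
    "\<And>j. j < n \<Longrightarrow> [int p] \<cdot> y j = lincomb R y (r j) j" by metis
  have "\<forall>u. \<exists>d. u \<in> carrier R \<longrightarrow> d \<in> digits p n \<and> u = lincomb R y d n"
    using bij unfolding bij_betw_def by blast
  then obtain dg where dg: "\<And>u. u \<in> carrier R \<Longrightarrow> dg u \<in> digits p n"
    "\<And>u. u \<in> carrier R \<Longrightarrow> lincomb R y (dg u) n = u" by metis
  have "\<forall>u. \<exists>d. u \<in> M \<longrightarrow> d \<in> digits p c \<and> u = lincomb R y d c"
    using p_basis_bij[OF y(1)] unfolding bij_betw_def by blast
  then obtain dM where dM: "\<And>u. u \<in> M \<Longrightarrow> dM u \<in> digits p c"
    "\<And>u. u \<in> M \<Longrightarrow> lincomb R y (dM u) c = u" by metis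
  \<comment> \<open>In layer 0 only positions below \<open>i\<close> carry information, as p y_i
    involves earlier basis elements; the filler 0 stays in the digit range.\<close>
  define B0 where "B0 t i k = (if t = 0 then if k < i then r i k else 0
    else if t = 1 then dg (v i) k else if t = 2 then dg \<one> k else dg (x (t - 3) \<otimes> y i) k)"
    for t i k :: nat
  define B where "B = restrict (\<lambda>(t, i, k). B0 t i k) ({..<s + 3} \<times> {..<n} \<times> {..<n})"
  define P where "P = restrict (\<lambda>(i, j, k). dM (v i \<otimes> v j) k) (triples (n - c) c)"
  have B0_mem: "B0 t i k \<in> {0..<int p}" if "t < s + 3" "i < n" "k < n" for t i k
  proof -
    have "dg u k \<in> {0..<int p}" if "u \<in> carrier R" for u
      using PiE_mem[OF dg(1)[OF that], of k] \<open>k < n\<close> by simp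
    then show ?thesis
      using r(1)[OF that(2), of k] p_gt_1 vR xR yR[OF that(2)] unfolding B0_def by auto
  qed
  have Beq: "B (t, i, k) = B0 t i k" if "t < s + 3" "i < n" "k < n" for t i k
    using that unfolding B_def by simp
  have "B \<in> ({..<s + 3} \<times> {..<n} \<times> {..<n}) \<rightarrow>\<^sub>E {0..<int p}"
    unfolding B_def using B0_mem by (intro restrict_PiE_iff[THEN iffD2]) auto
  moreover have "P \<in> triples (n - c) c \<rightarrow>\<^sub>E {0..<int p}"
    unfolding P_def triples_def using PiE_mem[OF dM(1)[OF vv]] by (intro restrict_PiE_iff[THEN iffD2]) auto
  ultimately have "(c, B, P) \<in> codes p n s" unfolding codes_def using c by simp
  moreover have "coded R p n s c B P"
    unfolding coded_def
  proof (rule exI[of _ y], rule exI[of _ v], rule exI[of _ x], intro conjI allI impI)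
    fix j assume j: "j < n"
    show "y j \<in> carrier R" by (rule yR[OF j])
    have "lincomb R y (r j) j = lincomb R y (\<lambda>k. B (0, j, k)) j"
      by (rule lincomb_cong) (use j in \<open>auto simp: Beq B0_def\<close>)
    then show "[int p] \<cdot> y j = lincomb R y (\<lambda>k. B (0, j, k)) j" using r(2)[OF j] by simp
  next
    show "bij_betw (\<lambda>d. lincomb R y d n) (digits p n) (carrier R)" by (rule bij)
  next
    fix i assume i: "i < n - c"
    have "lincomb R y (dg (v i)) n = lincomb R y (\<lambda>k. B (1, i, k)) n"
      by (rule lincomb_cong) (use i in \<open>auto simp: Beq B0_def\<close>)
    then show "v i = lincomb R y (\<lambda>k. B (1, i, k)) n" using dg(2)[OF vR] by simp
  next
    \<comment> \<open>\<open>n \<ge> 1\<close> makes row 0 available for the digits of 1.\<close>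
    have "lincomb R y (dg \<one>) n = lincomb R y (\<lambda>k. B (2, 0, k)) n"
      by (rule lincomb_cong) (use \<open>n \<ge> 1\<close> in \<open>auto simp: Beq B0_def\<close>)
    then show "\<one> = lincomb R y (\<lambda>k. B (2, 0, k)) n" using dg(2) by simp
  next
    show "x i \<in> carrier R" for i by (rule xR)
  next
    fix i j assume ij: "i < s" "j < n"
    have "lincomb R y (dg (x i \<otimes> y j)) n = lincomb R y (\<lambda>k. B (3 + i, j, k)) n"
      by (rule lincomb_cong) (use ij in \<open>auto simp: Beq B0_def\<close>)
    then show "x i \<otimes> y j = lincomb R y (\<lambda>k. B (3 + i, j, k)) n"
      using dg(2) xR yR[OF ij(2)] by simp
  next
    fix j i assume ij: "j < n - c" "i \<le> j"
    have "lincomb R y (dM (v i \<otimes> v j)) c = lincomb R y (\<lambda>k. P (i, j, k)) c"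
      by (rule lincomb_cong) (use ij in \<open>auto simp: P_def triples_def\<close>)
    then show "v i \<otimes> v j = lincomb R y (\<lambda>k. P (i, j, k)) c" using dM(2)[OF vv] by simp
  next
    fix N assume N: "asub N" "\<one> \<in> N" "\<forall>i<n - c. v i \<in> N" "\<forall>i<s. \<forall>u\<in>N. x i \<otimes> u \<in> N"
    have "V \<subseteq> N" using v(1) N(3) by auto
    moreover have "\<forall>x\<in>X. \<forall>u\<in>N. x \<otimes> u \<in> N" using x(1) N(4) by blast
    ultimately show "N = carrier R" using gen N by blast
  qed
  ultimately show ?thesis by blast
qed

section \<open>Transfer between rings with equal codes\<close>

text \<open>Carrying consults only the integers \<open>a\<close> and the table \<open>C\<close>,
  never the ring, so running it in parallel in \<open>R\<close> and \<open>S\<close> produces the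
  same digits.\<close>

lemma lincomb_simultaneous_reduction:
  assumes "ring R" "ring S" "k \<le> n" and p: "p > (0::nat)"
    and y: "\<And>j. j < n \<Longrightarrow> y j \<in> carrier R" "\<And>j. j < n \<Longrightarrow> z j \<in> carrier S"
    and rel: "\<And>j. j < n \<Longrightarrow> [int p] \<cdot>\<^bsub>R\<^esub> y j = lincomb R y (C j) j"
      "\<And>j. j < n \<Longrightarrow> [int p] \<cdot>\<^bsub>S\<^esub> z j = lincomb S z (C j) j"
  shows "\<exists>d\<in>digits p k. lincomb R y a k = lincomb R y d k \<and> lincomb S z a k = lincomb S z d k"
  using \<open>k \<le> n\<close>
proof (induction k arbitrary: a)
  case 0
  then show ?case by auto
next
  case (Suc k)
  interpret R: ring R by fact
  interpret S: ring S by fact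
  let ?a = "\<lambda>j. a j + (a k div int p) * C k j"
  obtain d where d: "d \<in> digits p k" "lincomb R y ?a k = lincomb R y d k"
    "lincomb S z ?a k = lincomb S z d k"
    using Suc.IH[of ?a] Suc.prems by auto
  define d' where "d' = d(k := a k mod int p)"
  have low: "lincomb R y d' k = lincomb R y d k" "lincomb S z d' k = lincomb S z d k"
    unfolding d'_def by (intro lincomb_cong; simp)+
  have d': "lincomb R y d' (Suc k) = lincomb R y d k \<oplus>\<^bsub>R\<^esub> [(a k mod int p)] \<cdot>\<^bsub>R\<^esub> y k"
    "lincomb S z d' (Suc k) = lincomb S z d k \<oplus>\<^bsub>S\<^esub> [(a k mod int p)] \<cdot>\<^bsub>S\<^esub> z k"
    using low unfolding d'_def by simp_all
  have "lincomb R y a (Suc k) = lincomb R y d' (Suc k)"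
    unfolding d' d(2)[symmetric] by (rule R.lincomb_carry) (use y(1) rel(1) Suc.prems in auto)
  moreover have "lincomb S z a (Suc k) = lincomb S z d' (Suc k)"
    unfolding d' d(3)[symmetric] by (rule S.lincomb_carry) (use y(2) rel(2) Suc.prems in auto)
  moreover have "d' \<in> digits p (Suc k)"
    unfolding d'_def lessThan_Suc by (rule PiE_fun_upd[OF _ d(1)]) (use p in simp)
  ultimately show ?case by blast
qed

text \<open>The difference of the two combinations reduces to a digit vector common to both rings.
  It vanishes in \<open>R\<close>, so injectivity makes all its digits zero. Used in both
  directions, this makes the map of \<open>coded_iso\<close> well defined and injective.\<close>

lemma lincomb_eq_transfer:
  assumes R: "ring R" and S: "ring S" and p: "p > (0::nat)"
    and y: "\<And>j. j < n \<Longrightarrow> y j \<in> carrier R" "\<And>j. j < n \<Longrightarrow> z j \<in> carrier S"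
    and rel: "\<And>j. j < n \<Longrightarrow> [int p] \<cdot>\<^bsub>R\<^esub> y j = lincomb R y (C j) j"
      "\<And>j. j < n \<Longrightarrow> [int p] \<cdot>\<^bsub>S\<^esub> z j = lincomb S z (C j) j"
    and inj: "inj_on (\<lambda>d. lincomb R y d n) (digits p n)"
    and eq: "lincomb R y a n = lincomb R y b n"
  shows "lincomb S z a n = lincomb S z b n"
proof -
  interpret R: ring R by fact
  interpret S: ring S by fact
  obtain d where d: "d \<in> digits p n" "lincomb R y (\<lambda>j. a j - b j) n = lincomb R y d n"
    "lincomb S z (\<lambda>j. a j - b j) n = lincomb S z d n"
    using lincomb_simultaneous_reduction[OF R S order_refl p y rel, where a = "\<lambda>j. a j - b j"]
    by blast
  have cR: "lincomb R y e n \<in> carrier R" and cS: "lincomb S z e n \<in> carrier S" for e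
    by (rule R.lincomb_closed[OF y(1)], assumption, rule S.lincomb_closed[OF y(2)])
  have mR: "lincomb R y (\<lambda>j. a j - b j) n = lincomb R y a n \<ominus>\<^bsub>R\<^esub> lincomb R y b n"
    by (rule R.lincomb_minus[OF y(1)])
  have mS: "lincomb S z (\<lambda>j. a j - b j) n = lincomb S z a n \<ominus>\<^bsub>S\<^esub> lincomb S z b n"
    by (rule S.lincomb_minus[OF y(2)])
  have "lincomb R y d n = \<zero>\<^bsub>R\<^esub>"
    using d(2) eq mR cR R.r_right_minus_eq by metis
  moreover define o' where "o' = (\<lambda>j\<in>{..<n}. 0::int)"
  have "lincomb R y o' n = \<zero>\<^bsub>R\<^esub>" unfolding o'_def by (rule R.lincomb_zero[OF _ y(1)]) auto
  moreover have "o' \<in> digits p n" unfolding o'_def using p by auto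
  ultimately have "d = o'" using inj d(1) unfolding inj_on_def by metis
  moreover have "lincomb S z o' n = \<zero>\<^bsub>S\<^esub>" unfolding o'_def by (rule S.lincomb_zero[OF _ y(2)]) auto
  ultimately have "lincomb S z a n \<ominus>\<^bsub>S\<^esub> lincomb S z b n = \<zero>\<^bsub>S\<^esub>"
    using d(3) mS by simp
  then show ?thesis using cS S.r_right_minus_eq by metis
qed

lemma (in ring) lincomb_pad:
  assumes "k \<le> n" "\<And>j. j < n \<Longrightarrow> y j \<in> carrier R"
  shows "lincomb R y (\<lambda>j. if j < k then a j else 0) n = lincomb R y a k"
  using assms
proof (induction n)
  case (Suc n)
  show ?case
  proof (cases "k = Suc n")
    case True
    show ?thesis unfolding True by (rule lincomb_cong) auto
  next
    case False
    then have "k \<le> n" using Suc.prems(1) by simp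
    then have "lincomb R y (\<lambda>j. if j < k then a j else 0) n = lincomb R y a k"
      using Suc.IH Suc.prems(2) by simp
    moreover have "lincomb R y a k \<in> carrier R"
      using \<open>k \<le> n\<close> Suc.prems(2) by (intro lincomb_closed) auto
    ultimately show ?thesis using \<open>k \<le> n\<close> by simp
  qed
qed simp

text \<open>Equal codes give an additive bijection \<open>\<theta>\<close> that intertwines the operators \<open>x\<^sub>i\<close> and
  respects the products \<open>v\<^sub>i v\<^sub>j\<close>; hence the elements on which it is multiplicative form a
  subgroup containing \<open>1\<close> and all \<open>v\<^sub>i\<close>, stable under the \<open>x\<^sub>i\<close>, which is everything.\<close>

lemma coded_iso:
  fixes R :: "'a ring" and S :: "'b ring"
  assumes "finite_p_ring R p n" "finite_p_ring S p n" "c \<le> n"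
    and "coded R p n s c B P" "coded S p n s c B P"
  shows "is_ring_iso R S"
proof -
  interpret R: finite_p_ring R p n by fact
  interpret S: finite_p_ring S p n by fact
  obtain y v x where
        y: "\<forall>j<n. y j \<in> carrier R \<and> [int p] \<cdot>\<^bsub>R\<^esub> y j = lincomb R y (\<lambda>k. B (0, j, k)) j"
    and ybij: "bij_betw (\<lambda>d. lincomb R y d n) (digits p n) (carrier R)"
    and v: "\<forall>i<n - c. v i = lincomb R y (\<lambda>k. B (1, i, k)) n"
    and oneR: "\<one>\<^bsub>R\<^esub> = lincomb R y (\<lambda>k. B (2, 0, k)) n"
    and x: "\<forall>i<s. x i \<in> carrier R \<and>
      (\<forall>j<n. x i \<otimes>\<^bsub>R\<^esub> y j = lincomb R y (\<lambda>k. B (3 + i, j, k)) n)"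
    and vv: "\<forall>j<n - c. \<forall>i\<le>j. v i \<otimes>\<^bsub>R\<^esub> v j = lincomb R y (\<lambda>k. P (i, j, k)) c"
    and gen: "\<forall>N. R.asub N \<longrightarrow> \<one>\<^bsub>R\<^esub> \<in> N \<longrightarrow> (\<forall>i<n - c. v i \<in> N) \<longrightarrow>
      (\<forall>i<s. \<forall>u\<in>N. x i \<otimes>\<^bsub>R\<^esub> u \<in> N) \<longrightarrow> N = carrier R"
    using assms(4) unfolding coded_def by (elim exE conjE) (rule that; assumption)
  obtain z w t where
        z: "\<forall>j<n. z j \<in> carrier S \<and> [int p] \<cdot>\<^bsub>S\<^esub> z j = lincomb S z (\<lambda>k. B (0, j, k)) j"
    and zbij: "bij_betw (\<lambda>d. lincomb S z d n) (digits p n) (carrier S)"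
    and w: "\<forall>i<n - c. w i = lincomb S z (\<lambda>k. B (1, i, k)) n"
    and oneS: "\<one>\<^bsub>S\<^esub> = lincomb S z (\<lambda>k. B (2, 0, k)) n"
    and t: "\<forall>i<s. t i \<in> carrier S \<and>
      (\<forall>j<n. t i \<otimes>\<^bsub>S\<^esub> z j = lincomb S z (\<lambda>k. B (3 + i, j, k)) n)"
    and ww: "\<forall>j<n - c. \<forall>i\<le>j. w i \<otimes>\<^bsub>S\<^esub> w j = lincomb S z (\<lambda>k. P (i, j, k)) c"
    using assms(5) unfolding coded_def by (elim exE conjE) (rule that; assumption)
  have yR: "y j \<in> carrier R" and zS: "z j \<in> carrier S" if "j < n" for j using y z that by auto
  have p: "p > 0" using R.p_gt_1 by simp
  have RR: "ring R" and SS: "ring S" by unfold_locales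
  have relR: "[int p] \<cdot>\<^bsub>R\<^esub> y j = lincomb R y (\<lambda>k. B (0, j, k)) j"
    and relS: "[int p] \<cdot>\<^bsub>S\<^esub> z j = lincomb S z (\<lambda>k. B (0, j, k)) j" if "j < n" for j
    using y z that by auto
  have injR: "inj_on (\<lambda>d. lincomb R y d n) (digits p n)"
    and injS: "inj_on (\<lambda>d. lincomb S z d n) (digits p n)"
    using ybij zbij bij_betw_imp_inj_on by auto
  have tr: "lincomb S z a n = lincomb S z b n" if "lincomb R y a n = lincomb R y b n" for a b
    by (rule lincomb_eq_transfer[OF RR SS p yR zS relR relS injR that])
  have tr': "lincomb R y a n = lincomb R y b n" if "lincomb S z a n = lincomb S z b n" for a b
    by (rule lincomb_eq_transfer[OF SS RR p zS yR relS relR injS that])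
  have clR: "lincomb R y a n \<in> carrier R" for a by (rule R.lincomb_closed[OF yR])
  have clS: "lincomb S z a n \<in> carrier S" for a by (rule S.lincomb_closed[OF zS])
  have surR: "\<exists>a. u = lincomb R y a n" if "u \<in> carrier R" for u
    using bij_betw_imp_surj_on[OF ybij] that by blast
  have surS: "\<exists>a. u = lincomb S z a n" if "u \<in> carrier S" for u
    using bij_betw_imp_surj_on[OF zbij] that by blast
  \<comment> \<open>By \<open>tr\<close> the value does not depend on the chosen coefficient
    vector.\<close>
  define \<theta> where "\<theta> u = lincomb S z (SOME a. lincomb R y a n = u) n" for u
  have \<theta>: "\<theta> (lincomb R y a n) = lincomb S z a n" for a
    unfolding \<theta>_def by (rule tr, rule someI[of _ a], rule refl)
  have \<theta>S: "\<theta> u \<in> carrier S" for u unfolding \<theta>_def by (rule clS)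
  have \<theta>add: "\<theta> (u \<oplus>\<^bsub>R\<^esub> u') = \<theta> u \<oplus>\<^bsub>S\<^esub> \<theta> u'" if u: "u \<in> carrier R" and u': "u' \<in> carrier R" for u u'
  proof -
    obtain a where a: "u = lincomb R y a n" using surR[OF u] by blast
    obtain b where b: "u' = lincomb R y b n" using surR[OF u'] by blast
    note ab = a b
    have "u \<oplus>\<^bsub>R\<^esub> u' = lincomb R y (\<lambda>j. a j + b j) n"
      unfolding ab by (rule R.lincomb_add[OF yR, symmetric])
    then have "\<theta> (u \<oplus>\<^bsub>R\<^esub> u') = lincomb S z (\<lambda>j. a j + b j) n" using \<theta> by simp
    also have "\<dots> = \<theta> u \<oplus>\<^bsub>S\<^esub> \<theta> u'" unfolding ab \<theta> by (rule S.lincomb_add[OF zS])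
    finally show ?thesis .
  qed
  have \<theta>scale: "\<theta> ([i] \<cdot>\<^bsub>R\<^esub> u) = [i] \<cdot>\<^bsub>S\<^esub> \<theta> u" if u: "u \<in> carrier R" for u and i :: int
  proof -
    obtain a where a: "u = lincomb R y a n" using surR[OF u] by blast
    have "[i] \<cdot>\<^bsub>R\<^esub> u = lincomb R y (\<lambda>j. i * a j) n"
      unfolding a by (rule R.lincomb_scale[OF yR, symmetric])
    then have "\<theta> ([i] \<cdot>\<^bsub>R\<^esub> u) = lincomb S z (\<lambda>j. i * a j) n" using \<theta> by simp
    also have "\<dots> = [i] \<cdot>\<^bsub>S\<^esub> \<theta> u" unfolding a \<theta> by (rule S.lincomb_scale[OF zS])
    finally show ?thesis .
  qed
  have \<theta>0: "\<theta> \<zero>\<^bsub>R\<^esub> = \<zero>\<^bsub>S\<^esub>" using \<theta>scale[of "\<zero>\<^bsub>R\<^esub>" 0] by simp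
  have \<theta>minus: "\<theta> (u \<ominus>\<^bsub>R\<^esub> u') = \<theta> u \<ominus>\<^bsub>S\<^esub> \<theta> u'" if "u \<in> carrier R" "u' \<in> carrier R" for u u'
  proof -
    have "\<theta> u = \<theta> ((u \<ominus>\<^bsub>R\<^esub> u') \<oplus>\<^bsub>R\<^esub> u')"
      using that by (simp add: R.minus_eq R.a_assoc R.l_neg)
    also have "\<dots> = \<theta> (u \<ominus>\<^bsub>R\<^esub> u') \<oplus>\<^bsub>S\<^esub> \<theta> u'" using that by (intro \<theta>add) auto
    finally show ?thesis using \<theta>S by (simp add: S.minus_eq S.a_assoc S.r_neg)
  qed
  have \<theta>lin: "\<theta> (lincomb R q a k) = lincomb S (\<lambda>j. \<theta> (q j)) a k"
    if "\<And>j. j < k \<Longrightarrow> q j \<in> carrier R" for q a k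
    using that
  proof (induction k)
    case 0
    then show ?case using \<theta>0 by simp
  next
    case (Suc k)
    have "lincomb R q a k \<in> carrier R" using Suc.prems by (intro R.lincomb_closed) auto
    then show ?case using Suc by (simp add: \<theta>add \<theta>scale)
  qed
  have \<theta>x: "\<theta> (x i \<otimes>\<^bsub>R\<^esub> u) = t i \<otimes>\<^bsub>S\<^esub> \<theta> u" if i: "i < s" and u: "u \<in> carrier R" for i u
  proof -
    have xi: "x i \<in> carrier R" and ti: "t i \<in> carrier S" using x t i by auto
    obtain a where a: "u = lincomb R y a n" using surR[OF u] by blast
    have "\<theta> (x i \<otimes>\<^bsub>R\<^esub> u) = \<theta> (lincomb R (\<lambda>j. x i \<otimes>\<^bsub>R\<^esub> y j) a n)"
      unfolding a using R.lincomb_mult[OF xi yR] by simp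
    also have "\<dots> = lincomb S (\<lambda>j. \<theta> (x i \<otimes>\<^bsub>R\<^esub> y j)) a n"
      by (rule \<theta>lin) (use xi yR in simp)
    also have "\<dots> = lincomb S (\<lambda>j. t i \<otimes>\<^bsub>S\<^esub> z j) a n"
      by (rule lincomb_cong) (use x t i \<theta> in auto)
    also have "\<dots> = t i \<otimes>\<^bsub>S\<^esub> \<theta> u"
      unfolding a \<theta> using S.lincomb_mult[OF ti zS] by simp
    finally show ?thesis .
  qed
  have \<theta>one: "\<theta> \<one>\<^bsub>R\<^esub> = \<one>\<^bsub>S\<^esub>" using \<theta> oneR oneS by simp
  have \<theta>v: "\<theta> (v i) = w i" if "i < n - c" for i using \<theta> v w that by simp
  have vR: "v i \<in> carrier R" and wS: "w i \<in> carrier S" if "i < n - c" for i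
    using v w that clR clS by auto
  have \<theta>vv': "\<theta> (v i \<otimes>\<^bsub>R\<^esub> v j) = w i \<otimes>\<^bsub>S\<^esub> w j" if "i \<le> j" "j < n - c" for i j
  proof -
    have "\<theta> (v i \<otimes>\<^bsub>R\<^esub> v j) = \<theta> (lincomb R y (\<lambda>k. P (i, j, k)) c)" using vv that by simp
    also have "\<dots> = lincomb S z (\<lambda>k. P (i, j, k)) c"
      using \<theta>[of "\<lambda>k. if k < c then P (i, j, k) else 0"]
        R.lincomb_pad[OF \<open>c \<le> n\<close> yR] S.lincomb_pad[OF \<open>c \<le> n\<close> zS] by simp
    also have "\<dots> = w i \<otimes>\<^bsub>S\<^esub> w j" using ww that by simp
    finally show ?thesis .
  qed
  have \<theta>vv: "\<theta> (v i \<otimes>\<^bsub>R\<^esub> v j) = \<theta> (v i) \<otimes>\<^bsub>S\<^esub> \<theta> (v j)" if "i < n - c" "j < n - c" for i j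
  proof (cases "i \<le> j")
    case True
    then show ?thesis using \<theta>vv' \<theta>v that by simp
  next
    case False
    then have "\<theta> (v j \<otimes>\<^bsub>R\<^esub> v i) = \<theta> (v j) \<otimes>\<^bsub>S\<^esub> \<theta> (v i)" using \<theta>vv' \<theta>v that by simp
    then show ?thesis using R.m_comm vR S.m_comm \<theta>S that by simp
  qed
  \<comment> \<open>Applied twice: at u = v i, where the hypothesis is the stored table of products,
    and then at arbitrary u, where commutativity turns the first application into the
    hypothesis.\<close>
  have mult_all: "\<theta> (u \<otimes>\<^bsub>R\<^esub> q) = \<theta> u \<otimes>\<^bsub>S\<^esub> \<theta> q"
    if u: "u \<in> carrier R" and uv: "\<And>i. i < n - c \<Longrightarrow> \<theta> (u \<otimes>\<^bsub>R\<^esub> v i) = \<theta> u \<otimes>\<^bsub>S\<^esub> \<theta> (v i)"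
      and q: "q \<in> carrier R" for u q
  proof -
    let ?N = "{q \<in> carrier R. \<theta> (u \<otimes>\<^bsub>R\<^esub> q) = \<theta> u \<otimes>\<^bsub>S\<^esub> \<theta> q}"
    have "R.asub ?N"
    proof (rule R.asubI)
      show "\<zero>\<^bsub>R\<^esub> \<in> ?N" using u \<theta>0 \<theta>S by simp
      fix a b assume ab: "a \<in> ?N" "b \<in> ?N"
      then have c: "a \<in> carrier R" "b \<in> carrier R" by auto
      have "u \<otimes>\<^bsub>R\<^esub> (a \<ominus>\<^bsub>R\<^esub> b) = u \<otimes>\<^bsub>R\<^esub> a \<ominus>\<^bsub>R\<^esub> u \<otimes>\<^bsub>R\<^esub> b" using u c by algebra
      moreover have "\<theta> u \<otimes>\<^bsub>S\<^esub> (\<theta> a \<ominus>\<^bsub>S\<^esub> \<theta> b) = \<theta> u \<otimes>\<^bsub>S\<^esub> \<theta> a \<ominus>\<^bsub>S\<^esub> \<theta> u \<otimes>\<^bsub>S\<^esub> \<theta> b"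
        using \<theta>S[of u] \<theta>S[of a] \<theta>S[of b] by algebra
      ultimately show "a \<ominus>\<^bsub>R\<^esub> b \<in> ?N" using ab c u \<theta>minus by simp
    qed auto
    moreover have "\<one>\<^bsub>R\<^esub> \<in> ?N" using u \<theta>one \<theta>S by simp
    moreover have "\<forall>i<n - c. v i \<in> ?N" using uv vR by simp
    moreover have "\<forall>i<s. \<forall>q\<in>?N. x i \<otimes>\<^bsub>R\<^esub> q \<in> ?N"
    proof (intro allI impI ballI)
      fix i q assume i: "i < s" and q: "q \<in> ?N"
      have xi: "x i \<in> carrier R" and ti: "t i \<in> carrier S" and qR: "q \<in> carrier R"
        using x t i q by auto
      have "\<theta> (u \<otimes>\<^bsub>R\<^esub> (x i \<otimes>\<^bsub>R\<^esub> q)) = \<theta> (x i \<otimes>\<^bsub>R\<^esub> (u \<otimes>\<^bsub>R\<^esub> q))"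
        using R.m_lcomm u xi qR by simp
      also have "\<dots> = t i \<otimes>\<^bsub>S\<^esub> (\<theta> u \<otimes>\<^bsub>S\<^esub> \<theta> q)" using \<theta>x[OF i] u q by simp
      also have "\<dots> = \<theta> u \<otimes>\<^bsub>S\<^esub> \<theta> (x i \<otimes>\<^bsub>R\<^esub> q)"
        using \<theta>x[OF i qR] S.m_lcomm ti \<theta>S by simp
      finally show "x i \<otimes>\<^bsub>R\<^esub> q \<in> ?N" using xi qR by simp
    qed
    ultimately have "?N = carrier R" using gen[rule_format, of ?N] by blast
    then show ?thesis using q by blast
  qed
  have \<theta>mult: "\<theta> (u \<otimes>\<^bsub>R\<^esub> q) = \<theta> u \<otimes>\<^bsub>S\<^esub> \<theta> q" if u: "u \<in> carrier R" and q: "q \<in> carrier R" for u q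
  proof (rule mult_all[OF u _ q])
    fix i assume i: "i < n - c"
    have "\<theta> (v i \<otimes>\<^bsub>R\<^esub> u) = \<theta> (v i) \<otimes>\<^bsub>S\<^esub> \<theta> u" by (rule mult_all[OF vR[OF i] \<theta>vv[OF i] u])
    then show "\<theta> (u \<otimes>\<^bsub>R\<^esub> v i) = \<theta> u \<otimes>\<^bsub>S\<^esub> \<theta> (v i)"
      using R.m_comm[OF u vR[OF i]] S.m_comm[OF \<theta>S \<theta>S] by simp
  qed
  have "\<theta> \<in> ring_hom R S"
    using \<theta>S \<theta>mult \<theta>add \<theta>one by (intro ring_hom_memI) auto
  moreover have "bij_betw \<theta> (carrier R) (carrier S)"
    unfolding bij_betw_def
  proof
    show "inj_on \<theta> (carrier R)"
    proof (rule inj_onI)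
      fix u u' assume uu: "u \<in> carrier R" "u' \<in> carrier R" "\<theta> u = \<theta> u'"
      obtain a where a: "u = lincomb R y a n" using surR[OF uu(1)] by blast
      obtain b where b: "u' = lincomb R y b n" using surR[OF uu(2)] by blast
      show "u = u'" unfolding a b by (rule tr') (use uu(3) \<theta> a b in simp)
    qed
    show "\<theta> ` carrier R = carrier S"
    proof
      show "\<theta> ` carrier R \<subseteq> carrier S" using \<theta>S by auto
      show "carrier S \<subseteq> \<theta> ` carrier R"
      proof
        fix u assume "u \<in> carrier S"
        then obtain a where "u = lincomb S z a n" using surS by blast
        then have "u = \<theta> (lincomb R y a n)" using \<theta> by simp
        then show "u \<in> \<theta> ` carrier R" using clR by blast
      qed
    qed
  qed
  ultimately show ?thesis unfolding is_ring_iso_def ring_iso_def by blast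
qed

subsection \<open>Rings defined by symmetric bilinear maps\<close>

locale graded_ring =
  fixes p a b :: nat
  assumes p: "p > 1"
begin

definition n :: nat where "n = Suc (a + b)"

definition red :: "(nat \<Rightarrow> int) \<Rightarrow> (nat \<Rightarrow> int)"
  where "red x = (\<lambda>k\<in>{..<n}. x k mod int p)"

text \<open>Coordinate 0 belongs to K, \<open>Suc i\<close> with i < a to U, and
  \<open>Suc (a + k)\<close> with k < b to W. Reading \<open>f\<close> at (min i j, max i j) builds
  in symmetry while leaving its values on \<open>triples a b\<close> free.\<close>

definition bil :: "(nat \<times> nat \<times> nat \<Rightarrow> int) \<Rightarrow> nat \<Rightarrow> (nat \<Rightarrow> int) \<Rightarrow> (nat \<Rightarrow> int) \<Rightarrow> int"
  where "bil f k x y = (if k \<le> a then 0 else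
    (\<Sum>i<a. \<Sum>j<a. f (min i j, max i j, k - Suc a) * (x (Suc i) * y (Suc j))))"

text \<open>Acting on unreduced integer vectors makes the ring laws exact integer identities, which
  pass through \<open>red\<close> by congruences.\<close>

definition mul :: "(nat \<times> nat \<times> nat \<Rightarrow> int) \<Rightarrow> (nat \<Rightarrow> int) \<Rightarrow> (nat \<Rightarrow> int) \<Rightarrow> nat \<Rightarrow> int"
  where "mul f x y k = (if k = 0 then x 0 * y 0 else x 0 * y k + x k * y 0 + bil f k x y)"

text \<open>The ring \<open>K \<oplus> U \<oplus> W\<close> over \<open>K = \<int>/p\<close> with \<open>dim U = a\<close>, \<open>dim W = b\<close>, in which \<open>U\<close> is
  multiplied into \<open>W\<close> by the symmetric bilinear map with coefficients \<open>f\<close> and \<open>(U \<oplus> W) W = 0\<close>.\<close>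

definition bil_ring :: "(nat \<times> nat \<times> nat \<Rightarrow> int) \<Rightarrow> (nat \<Rightarrow> int) ring"
  where "bil_ring f = \<lparr>carrier = {..<n} \<rightarrow>\<^sub>E {0..<int p}, mult = (\<lambda>x y. red (mul f x y)),
    one = red (\<lambda>k. if k = 0 then 1 else 0), zero = red (\<lambda>_. 0),
    add = (\<lambda>x y. red (\<lambda>k. x k + y k))\<rparr>"

lemma bil_ring_simps:
  "carrier (bil_ring f) = {..<n} \<rightarrow>\<^sub>E {0..<int p}"
  "x \<otimes>\<^bsub>bil_ring f\<^esub> y = red (mul f x y)" "\<one>\<^bsub>bil_ring f\<^esub> = red (\<lambda>k. if k = 0 then 1 else 0)"
  "\<zero>\<^bsub>bil_ring f\<^esub> = red (\<lambda>_. 0)" "x \<oplus>\<^bsub>bil_ring f\<^esub> y = red (\<lambda>k. x k + y k)"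
  unfolding bil_ring_def by simp_all

lemma red_closed: "red x \<in> {..<n} \<rightarrow>\<^sub>E {0..<int p}"
  unfolding red_def using p by auto

lemma red_id: "x \<in> {..<n} \<rightarrow>\<^sub>E {0..<int p} \<Longrightarrow> red x = x"
  unfolding red_def by (auto simp: fun_eq_iff PiE_def extensional_def Pi_def)

lemma red_eqI: "(\<And>k. k < n \<Longrightarrow> [x k = y k] (mod int p)) \<Longrightarrow> red x = red y"
  unfolding red_def cong_def by auto

lemma red_cong: "k < n \<Longrightarrow> [red x k = x k] (mod int p)"
  unfolding red_def by simp

lemma bil_cong:
  assumes "\<And>k. k < n \<Longrightarrow> [x k = x' k] (mod int p)" "\<And>k. k < n \<Longrightarrow> [y k = y' k] (mod int p)"
  shows "[bil f k x y = bil f k x' y'] (mod int p)"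
  unfolding bil_def
  using assms by (auto simp: n_def intro!: cong_sum cong_mult)

lemma mul_cong:
  assumes "\<And>k. k < n \<Longrightarrow> [x k = x' k] (mod int p)" "\<And>k. k < n \<Longrightarrow> [y k = y' k] (mod int p)"
    and "k < n"
  shows "[mul f x y k = mul f x' y' k] (mod int p)"
  using assms bil_cong[OF assms(1,2)] unfolding mul_def
  by (auto simp: n_def intro!: cong_add cong_mult)

lemma red_mul_red:
  "red (mul f (red x) y) = red (mul f x y)" "red (mul f x (red y)) = red (mul f x y)"
  by (intro red_eqI mul_cong red_cong cong_refl; assumption)+

lemma red_add_red:
  "red (\<lambda>k. red x k + y k) = red (\<lambda>k. x k + y k)" "red (\<lambda>k. x k + red y k) = red (\<lambda>k. x k + y k)"
  by (intro red_eqI cong_add red_cong cong_refl; assumption)+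

lemma bil_sym: "bil f k x y = bil f k y x"
proof -
  have "(\<Sum>i<a. \<Sum>j<a. f (min i j, max i j, k - Suc a) * (x (Suc i) * y (Suc j))) =
    (\<Sum>j<a. \<Sum>i<a. f (min i j, max i j, k - Suc a) * (x (Suc i) * y (Suc j)))"
    by (rule sum.swap)
  also have "\<dots> = (\<Sum>i<a. \<Sum>j<a. f (min i j, max i j, k - Suc a) * (y (Suc i) * x (Suc j)))"
    by (intro sum.cong refl) (simp add: min.commute max.commute mult.commute)
  finally show ?thesis unfolding bil_def by simp
qed

lemma bil_add: "bil f k (\<lambda>k. x k + y k) z = bil f k x z + bil f k y z"
  unfolding bil_def by (simp add: sum.distrib algebra_simps)

lemma bil_unit: "bil f k (\<lambda>k. if k = 0 then 1 else 0) y = 0"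
  unfolding bil_def by simp

text \<open>Only the scalar parts of a product reach the U-coordinates. Threefold products from U
  thus vanish, and associativity holds for every \<open>f\<close>.\<close>

lemma bil_mul: "bil f k (mul f x y) z = x 0 * bil f k y z + y 0 * bil f k x z"
proof (cases "k \<le> a")
  case False
  have "mul f x y (Suc i) = x 0 * y (Suc i) + y 0 * x (Suc i)" if "i < a" for i
    using that unfolding mul_def bil_def by simp
  then show ?thesis
    using False unfolding bil_def
    by (simp add: sum.distrib sum_distrib_left algebra_simps)
qed (simp add: bil_def)

lemma mul_comm: "mul f x y = mul f y x"
  unfolding mul_def using bil_sym[of f _ x y] by (auto simp: fun_eq_iff)

lemma mul_assoc: "mul f (mul f x y) z = mul f x (mul f y z)"
proof
  fix k
  have "bil f k (mul f x y) z = x 0 * bil f k y z + y 0 * bil f k x z" by (rule bil_mul)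
  moreover have "bil f k x (mul f y z) = y 0 * bil f k x z + z 0 * bil f k x y"
    using bil_mul[of f k y z x] bil_sym by metis
  ultimately show "mul f (mul f x y) z k = mul f x (mul f y z) k"
    by (simp add: mul_def[of f "mul f x y"] mul_def[of f x "mul f y z"])
      (simp add: mul_def algebra_simps)
qed

lemma mul_distrib: "mul f (\<lambda>k. x k + y k) z = (\<lambda>k. mul f x z k + mul f y z k)"
  unfolding mul_def by (auto simp: fun_eq_iff bil_add algebra_simps)

lemma mul_one: "mul f (\<lambda>k. if k = 0 then 1 else 0) x = x"
  unfolding mul_def by (auto simp: fun_eq_iff bil_unit)

lemma cring_bil_ring: "cring (bil_ring f)"
proof (rule cringI)
  show "abelian_group (bil_ring f)"
  proof (rule abelian_groupI)
    fix x y z assume "x \<in> carrier (bil_ring f)" "y \<in> carrier (bil_ring f)" "z \<in> carrier (bil_ring f)"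
    show "(x \<oplus>\<^bsub>bil_ring f\<^esub> y) \<oplus>\<^bsub>bil_ring f\<^esub> z = x \<oplus>\<^bsub>bil_ring f\<^esub> (y \<oplus>\<^bsub>bil_ring f\<^esub> z)"
      unfolding bil_ring_simps red_add_red by (simp add: add.assoc)
  next
    fix x assume x: "x \<in> carrier (bil_ring f)"
    show "\<zero>\<^bsub>bil_ring f\<^esub> \<oplus>\<^bsub>bil_ring f\<^esub> x = x"
      using red_id x unfolding bil_ring_simps red_add_red by simp
    have "red (\<lambda>k. - x k) \<oplus>\<^bsub>bil_ring f\<^esub> x = \<zero>\<^bsub>bil_ring f\<^esub>"
      unfolding bil_ring_simps red_add_red by simp
    then show "\<exists>y\<in>carrier (bil_ring f). y \<oplus>\<^bsub>bil_ring f\<^esub> x = \<zero>\<^bsub>bil_ring f\<^esub>"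
      using red_closed unfolding bil_ring_simps by blast
  qed (auto simp: bil_ring_simps red_closed add.commute)
  show "Group.comm_monoid (bil_ring f)"
  proof (rule comm_monoidI)
    fix x y z assume "x \<in> carrier (bil_ring f)" "y \<in> carrier (bil_ring f)" "z \<in> carrier (bil_ring f)"
    show "(x \<otimes>\<^bsub>bil_ring f\<^esub> y) \<otimes>\<^bsub>bil_ring f\<^esub> z = x \<otimes>\<^bsub>bil_ring f\<^esub> (y \<otimes>\<^bsub>bil_ring f\<^esub> z)"
      unfolding bil_ring_simps red_mul_red by (simp add: mul_assoc)
  next
    fix x assume x: "x \<in> carrier (bil_ring f)"
    show "\<one>\<^bsub>bil_ring f\<^esub> \<otimes>\<^bsub>bil_ring f\<^esub> x = x"
      using red_id x unfolding bil_ring_simps red_mul_red mul_one by simp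
  next
    fix x y
    show "x \<otimes>\<^bsub>bil_ring f\<^esub> y = y \<otimes>\<^bsub>bil_ring f\<^esub> x"
      unfolding bil_ring_simps by (subst mul_comm) (rule refl)
  qed (auto simp: bil_ring_simps red_closed)
  fix x y z assume "x \<in> carrier (bil_ring f)" "y \<in> carrier (bil_ring f)" "z \<in> carrier (bil_ring f)"
  show "(x \<oplus>\<^bsub>bil_ring f\<^esub> y) \<otimes>\<^bsub>bil_ring f\<^esub> z = x \<otimes>\<^bsub>bil_ring f\<^esub> z \<oplus>\<^bsub>bil_ring f\<^esub> y \<otimes>\<^bsub>bil_ring f\<^esub> z"
    unfolding bil_ring_simps red_mul_red red_add_red mul_distrib by (rule refl)
qed

lemma order_bil_ring: "order (bil_ring f) = p ^ n"
  unfolding order_def bil_ring_simps by (simp add: card_PiE)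

section \<open>Counting isomorphisms within the family\<close>

definition e :: "nat \<Rightarrow> nat \<Rightarrow> int"
  where "e k = (\<lambda>j\<in>{..<n}. if j = k then 1 else 0)"

lemma e_closed: "e k \<in> {..<n} \<rightarrow>\<^sub>E {0..<int p}"
  unfolding e_def using p by auto

text \<open>Induction on the digit sum, lowering a nonzero digit by one. It serves to show that
  homomorphisms agreeing on all \<open>e k\<close> agree everywhere.\<close>

lemma additive_generation:
  assumes "red (\<lambda>_. 0) \<in> N"
    and "\<And>x k. x \<in> N \<Longrightarrow> k < n \<Longrightarrow> red (\<lambda>j. x j + e k j) \<in> N"
    and "x \<in> {..<n} \<rightarrow>\<^sub>E {0..<int p}"
  shows "x \<in> N"
  using assms(3)
proof (induction "nat (\<Sum>k<n. x k)" arbitrary: x rule: less_induct)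
  case less
  show ?case
  proof (cases "\<forall>k<n. x k = 0")
    case True
    then have "x = red (\<lambda>_. 0)"
      using less.prems unfolding red_def by (auto simp: fun_eq_iff PiE_def extensional_def)
    then show ?thesis using assms(1) by simp
  next
    case False
    then obtain k where k: "k < n" "x k \<noteq> 0" by blast
    have nn: "x j \<ge> 0" "x j < int p" if "j < n" for j using PiE_mem[OF less.prems, of j] that by auto
    define x' where "x' = x(k := x k - 1)"
    have x': "x' \<in> {..<n} \<rightarrow>\<^sub>E {0..<int p}"
      using less.prems nn[OF k(1)] k unfolding x'_def by (auto simp: PiE_def Pi_def extensional_def)
    have "(\<Sum>j<n. x j) = (\<Sum>j<n. x' j) + 1"
    proof -
      have "(\<Sum>j<n. x j) = (\<Sum>j<n. x' j + (if j = k then 1 else 0))"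
        unfolding x'_def by (intro sum.cong) auto
      then show ?thesis using k by (simp add: sum.distrib)
    qed
    moreover have "(\<Sum>j<n. x' j) \<ge> 0"
      using PiE_mem[OF x'] by (intro sum_nonneg) auto
    ultimately have "nat (\<Sum>j<n. x' j) < nat (\<Sum>j<n. x j)" by simp
    then have "x' \<in> N" using less.hyps x' by blast
    then have "red (\<lambda>j. x' j + e k j) \<in> N" using assms(2) k by blast
    moreover have "red (\<lambda>j. x' j + e k j) = red x"
      by (rule red_eqI) (auto simp: x'_def e_def)
    ultimately show ?thesis using red_id less.prems by simp
  qed
qed

lemma mul_e:
  assumes "(i, j, k) \<in> triples a b" "f (i, j, k) \<in> {0..<int p}"
  shows "(e (Suc i) \<otimes>\<^bsub>bil_ring f\<^esub> e (Suc j)) (Suc (a + k)) = f (i, j, k)"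
proof -
  have ij: "i \<le> j" "j < a" "k < b" using assms(1) unfolding triples_def by auto
  have E: "e (Suc i) (Suc m) = (if m = i then 1 else 0)"
    "e (Suc j) (Suc m) = (if m = j then 1 else 0)" if "m < a" for m
    using that unfolding e_def n_def by auto
  have "bil f (Suc (a + k)) (e (Suc i)) (e (Suc j)) =
    (\<Sum>i'<a. \<Sum>j'<a. if i' = i then if j' = j then f (min i' j', max i' j', k) else 0 else 0)"
    unfolding bil_def by (simp, intro sum.cong refl) (simp add: E)
  also have "\<dots> = (\<Sum>i'<a. if i' = i then f (min i' j, max i' j, k) else 0)"
    using ij by (intro sum.cong refl) simp
  also have "\<dots> = f (i, j, k)" using ij by (simp add: min_def max_def)
  finally show ?thesis
    using ij assms(2) unfolding bil_ring_simps red_def mul_def e_def n_def by simp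
qed

text \<open>An isomorphism out of \<open>bil_ring f0\<close> is fixed by the images of the n
  elements \<open>e k\<close>, each with p^n possible values. It also determines \<open>f\<close>:
  it transports the multiplication to \<open>bil_ring f\<close>, where \<open>mul_e\<close> reads
  off the coefficients.\<close>

lemma card_iso_fibre:
  "card {f \<in> triples a b \<rightarrow>\<^sub>E {0..<int p}. is_ring_iso (bil_ring f0) (bil_ring f)} \<le> p ^ (n * n)"
proof -
  define Fib where "Fib = {f \<in> triples a b \<rightarrow>\<^sub>E {0..<int p}. is_ring_iso (bil_ring f0) (bil_ring f)}"
  define A where "A = ({..<n} \<rightarrow>\<^sub>E {0..<int p})"
  have cA: "carrier (bil_ring f) = A" for f unfolding bil_ring_simps A_def by simp
  have "\<forall>f\<in>Fib. \<exists>h. h \<in> ring_iso (bil_ring f0) (bil_ring f)"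
    unfolding Fib_def is_ring_iso_def by auto
  then obtain h where h: "\<And>f. f \<in> Fib \<Longrightarrow> h f \<in> ring_iso (bil_ring f0) (bil_ring f)" by metis
  have hom: "h f \<in> ring_hom (bil_ring f0) (bil_ring f)" and bij: "bij_betw (h f) A A" if "f \<in> Fib" for f
    using h[OF that] cA unfolding ring_iso_def by auto
  have hA: "h f x \<in> A" if "f \<in> Fib" "x \<in> A" for f x
    using bij_betwE[OF bij] that by blast
  define \<Psi> where "\<Psi> f = (\<lambda>k\<in>{..<n}. h f (e k))" for f
  have eA: "e k \<in> A" for k unfolding A_def by (rule e_closed)
  have "inj_on \<Psi> Fib"
  proof (rule inj_onI)
    fix f g assume f: "f \<in> Fib" and g: "g \<in> Fib" and eq: "\<Psi> f = \<Psi> g"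
    have he: "h f (e k) = h g (e k)" if "k < n" for k
      using fun_cong[OF eq, of k] that unfolding \<Psi>_def by simp
    have hh: "h f x = h g x" if "x \<in> A" for x
    proof -
      define N where "N = {x \<in> A. h f x = h g x}"
      have "x \<in> N"
      proof (rule additive_generation[OF _ _ that[unfolded A_def]])
        have r: "ring (bil_ring q)" for q using cring_bil_ring cring.axioms by blast
        have "h f \<zero>\<^bsub>bil_ring f0\<^esub> = h g \<zero>\<^bsub>bil_ring f0\<^esub>"
          using ring_hom_zero[OF hom[OF f] r r] ring_hom_zero[OF hom[OF g] r r]
          by (simp add: bil_ring_simps)
        then show "red (\<lambda>_. 0) \<in> N" using red_closed unfolding N_def A_def bil_ring_simps by simp
        fix x k assume x: "x \<in> N" and k: "k < n"
        then have xA: "x \<in> A" unfolding N_def by simp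
        have "h f (x \<oplus>\<^bsub>bil_ring f0\<^esub> e k) = h f x \<oplus>\<^bsub>bil_ring f\<^esub> h f (e k)"
          using ring_hom_add[OF hom[OF f]] xA eA cA by simp
        \<comment> \<open>Addition does not involve the coefficients, so sums in
          \<open>bil_ring f\<close> and \<open>bil_ring g\<close> coincide.\<close>
        also have "\<dots> = h g x \<oplus>\<^bsub>bil_ring g\<^esub> h g (e k)"
          using x he[OF k] unfolding N_def by (simp add: bil_ring_simps)
        also have "\<dots> = h g (x \<oplus>\<^bsub>bil_ring f0\<^esub> e k)"
          using ring_hom_add[OF hom[OF g]] xA eA cA by simp
        finally show "red (\<lambda>j. x j + e k j) \<in> N"
          using red_closed unfolding N_def A_def bil_ring_simps by simp
      qed
      then show ?thesis unfolding N_def by simp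
    qed
    have mult: "u \<otimes>\<^bsub>bil_ring f\<^esub> u' = u \<otimes>\<^bsub>bil_ring g\<^esub> u'" if u: "u \<in> A" and u': "u' \<in> A" for u u'
    proof -
      have sur: "h f ` A = A" by (rule bij_betw_imp_surj_on[OF bij[OF f]])
      obtain q where q: "q \<in> A" "u = h f q" using u sur by blast
      obtain q' where q': "q' \<in> A" "u' = h f q'" using u' sur by blast
      have qq: "q \<otimes>\<^bsub>bil_ring f0\<^esub> q' \<in> A" using red_closed unfolding bil_ring_simps A_def by simp
      have "u \<otimes>\<^bsub>bil_ring f\<^esub> u' = h f (q \<otimes>\<^bsub>bil_ring f0\<^esub> q')"
        using ring_hom_mult[OF hom[OF f]] q q' cA by simp
      also have "\<dots> = h g q \<otimes>\<^bsub>bil_ring g\<^esub> h g q'"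
        using ring_hom_mult[OF hom[OF g]] q(1) q'(1) cA hh[OF qq] by simp
      also have "\<dots> = u \<otimes>\<^bsub>bil_ring g\<^esub> u'" using hh q q' by simp
      finally show ?thesis .
    qed
    show "f = g"
    proof (rule PiE_ext)
      show "f \<in> triples a b \<rightarrow>\<^sub>E {0..<int p}" "g \<in> triples a b \<rightarrow>\<^sub>E {0..<int p}"
        using f g unfolding Fib_def by auto
      then have mem: "f t \<in> {0..<int p}" "g t \<in> {0..<int p}" if "t \<in> triples a b" for t
        using that PiE_mem by metis+
      fix t assume t: "t \<in> triples a b"
      obtain i j k where tt: "t = (i, j, k)" by (cases t) auto
      show "f t = g t"
        using mul_e[of i j k f] mul_e[of i j k g] mult[OF eA eA] t mem[OF t] unfolding tt by simp
    qed
  qed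
  moreover have "\<Psi> ` Fib \<subseteq> {..<n} \<rightarrow>\<^sub>E A"
    unfolding \<Psi>_def using hA eA by auto
  moreover have "finite ({..<n} \<rightarrow>\<^sub>E A)" unfolding A_def by (intro finite_PiE) auto
  ultimately have "card Fib \<le> card ({..<n} \<rightarrow>\<^sub>E A)" by (rule card_inj_on_le)
  also have "\<dots> = p ^ (n * n)" unfolding A_def by (simp add: card_PiE power_mult)
  finally show ?thesis unfolding Fib_def .
qed

text \<open>Coefficient families are sorted by the class of their ring, each class receiving at most
  p^(n*n). Finiteness is assumed because \<open>card\<close> of an infinite set is 0.\<close>

lemma card_le_num_comm_rings:
  assumes fin: "finite (comm_rings_of_card (p ^ n) // ring_iso_rel (p ^ n))"
  shows "p ^ card (triples a b) \<le> num_comm_rings (p ^ n) * p ^ (n * n)"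
proof -
  define \<Phi> where "\<Phi> = (triples a b \<rightarrow>\<^sub>E {0..<int p})"
  let ?Q = "comm_rings_of_card (p ^ n) // ring_iso_rel (p ^ n)"
  have "\<exists>S\<in>comm_rings_of_card (p ^ n). is_ring_iso (bil_ring f) S" for f
    using comm_rings_of_card_complete[OF cring_bil_ring order_bil_ring] p by simp
  then obtain S where S: "\<And>f. S f \<in> comm_rings_of_card (p ^ n)" "\<And>f. is_ring_iso (bil_ring f) (S f)"
    by metis
  define cl where "cl f = ring_iso_rel (p ^ n) `` {S f}" for f
  have cl: "cl f \<in> ?Q" for f unfolding cl_def by (rule quotientI[OF S(1)])
  have iso: "is_ring_iso (bil_ring f) (bil_ring g)" if "cl f = cl g" for f g
  proof -
    have "(S f, S g) \<in> ring_iso_rel (p ^ n)"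
      using that eq_equiv_class[OF _ equiv_ring_iso_rel S(1)] unfolding cl_def by blast
    then have 1: "is_ring_iso (S f) (S g)" unfolding ring_iso_rel_def by simp
    have 2: "is_ring_iso (S g) (bil_ring g)"
      using ring_iso_sym[OF cring.axioms(1)[OF cring_bil_ring] S(2)] .
    show ?thesis by (rule ring_iso_trans[OF ring_iso_trans[OF S(2) 1] 2])
  qed
  have fin\<Phi>: "finite \<Phi>" unfolding \<Phi>_def using finite_triples by (intro finite_PiE) auto
  have "card \<Phi> = (\<Sum>A\<in>cl ` \<Phi>. card {f \<in> \<Phi>. cl f = A})"
    using sum.image_gen[OF fin\<Phi>, of "\<lambda>_. 1::nat" cl] by simp
  also have "\<dots> \<le> (\<Sum>A\<in>cl ` \<Phi>. p ^ (n * n))"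
  proof (rule sum_mono)
    fix A assume "A \<in> cl ` \<Phi>"
    then obtain f0 where f0: "A = cl f0" by blast
    have "{f \<in> \<Phi>. cl f = A} \<subseteq> {f \<in> triples a b \<rightarrow>\<^sub>E {0..<int p}. is_ring_iso (bil_ring f0) (bil_ring f)}"
      using iso[of f0] unfolding \<Phi>_def f0 by auto
    then have "card {f \<in> \<Phi>. cl f = A} \<le>
        card {f \<in> triples a b \<rightarrow>\<^sub>E {0..<int p}. is_ring_iso (bil_ring f0) (bil_ring f)}"
      using fin\<Phi> unfolding \<Phi>_def by (intro card_mono) auto
    then show "card {f \<in> \<Phi>. cl f = A} \<le> p ^ (n * n)" using card_iso_fibre[of f0] by linarith
  qed
  also have "\<dots> = card (cl ` \<Phi>) * p ^ (n * n)" by simp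
  also have "\<dots> \<le> num_comm_rings (p ^ n) * p ^ (n * n)"
  proof (rule mult_right_mono)
    show "card (cl ` \<Phi>) \<le> num_comm_rings (p ^ n)"
      unfolding num_comm_rings_def by (rule card_mono[OF fin]) (use cl in blast)
  qed simp
  finally show ?thesis unfolding \<Phi>_def using finite_triples by (simp add: card_PiE)
qed

end

subsection \<open>Counting\<close>

text \<open>Infinitely many rings on sets of naturals have order p^n, so even finiteness of the set
  of classes rests on the injection sending a class to the code of a chosen member.\<close>

lemma num_comm_rings_le_codes:
  assumes p: "Factorial_Ring.prime p" and n: "n \<ge> 1"
    and s: "s = 5 * floor_sqrt n + 2 * Suc (floor_sqrt (p * n)) + 1"
  shows "finite (comm_rings_of_card (p ^ n) // ring_iso_rel (p ^ n))"
    and "num_comm_rings (p ^ n) \<le> card (codes p n s)"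
proof -
  let ?X = "comm_rings_of_card (p ^ n)" and ?r = "ring_iso_rel (p ^ n)"
  have fpr: "finite_p_ring R p n" if "R \<in> ?X" for R
    using that p unfolding comm_rings_of_card_def finite_p_ring_def finite_p_ring_axioms_def by simp
  have "\<exists>t. t \<in> codes p n s \<and> (\<exists>c B P. t = (c, B, P) \<and> coded R p n s c B P)" if "R \<in> ?X" for R
    using coded_exists[of R p n s] that p n s unfolding comm_rings_of_card_def by blast
  then obtain code where code: "\<And>R. R \<in> ?X \<Longrightarrow> code R \<in> codes p n s"
    "\<And>R. R \<in> ?X \<Longrightarrow> \<exists>c B P. code R = (c, B, P) \<and> coded R p n s c B P"
    by metis
  have iso: "is_ring_iso R S" if RS: "R \<in> ?X" "S \<in> ?X" "code R = code S" for R S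
  proof -
    obtain c B P where 1: "code R = (c, B, P)" "coded R p n s c B P" using code(2)[OF RS(1)] by blast
    have 2: "coded S p n s c B P" using code(2)[OF RS(2)] RS(3) 1(1) by auto
    have "c \<le> n" using code(1)[OF RS(1)] 1(1) unfolding codes_def by simp
    then show ?thesis by (rule coded_iso[OF fpr[OF RS(1)] fpr[OF RS(2)] _ 1(2) 2])
  qed
  define rep where "rep A = (SOME R. R \<in> A)" for A :: "nat ring set"
  have rep: "rep A \<in> A" "rep A \<in> ?X" if A: "A \<in> ?X // ?r" for A
  proof -
    have "A \<noteq> {}" by (rule in_quotient_imp_non_empty[OF equiv_ring_iso_rel A])
    then show "rep A \<in> A" unfolding rep_def by (simp add: some_in_eq)
    then show "rep A \<in> ?X" using in_quotient_imp_subset[OF equiv_ring_iso_rel A] by blast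
  qed
  have inj: "inj_on (\<lambda>A. code (rep A)) (?X // ?r)"
  proof (rule inj_onI)
    fix A A' assume A: "A \<in> ?X // ?r" and A': "A' \<in> ?X // ?r" and eq: "code (rep A) = code (rep A')"
    have "(rep A, rep A') \<in> ?r"
      unfolding ring_iso_rel_def using rep[OF A] rep[OF A'] iso eq by simp
    then show "A = A'"
      using quotient_eq_iff[OF equiv_ring_iso_rel A A' rep(1)[OF A] rep(1)[OF A']] by simp
  qed
  have fin: "finite (codes p n s)"
    unfolding codes_def by (intro finite_SigmaI finite_cartesian_product finite_PiE finite_triples) auto
  have sub: "(\<lambda>A. code (rep A)) ` (?X // ?r) \<subseteq> codes p n s"
    using code(1) rep(2) by blast
  show "finite (?X // ?r)" by (rule inj_on_finite[OF inj sub fin])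
  show "num_comm_rings (p ^ n) \<le> card (codes p n s)"
    unfolding num_comm_rings_def by (rule card_inj_on_le[OF inj sub fin])
qed

section \<open>Numerical estimates\<close>

lemma card_codes:
  "card (codes p n s) = (\<Sum>c\<le>n. p ^ ((s + 3) * (n * n)) * p ^ card (triples (n - c) c))"
  unfolding codes_def
  by (subst card_SigmaI)
    (auto intro!: finite_PiE finite_triples sum.cong
      simp: card_cartesian_product card_PiE finite_triples)

lemma cubic_bound:
  fixes a c :: real
  assumes "a \<ge> 0" "c \<ge> 0"
  shows "27 * (a\<^sup>2 * c) \<le> 4 * (a + c) ^ 3"
proof -
  have "4 * (a + c) ^ 3 - 27 * (a\<^sup>2 * c) = (a - 2 * c)\<^sup>2 * (4 * a + c)"
    by (simp add: power2_eq_square power3_eq_cube algebra_simps)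
  moreover have "(a - 2 * c)\<^sup>2 * (4 * a + c) \<ge> 0" using assms by simp
  ultimately show ?thesis by linarith
qed

lemma card_triples_le:
  assumes "c \<le> n"
  shows "real (card (triples (n - c) c)) \<le> 2 / 27 * real n ^ 3 + real n ^ 2"
proof -
  define a where "a = n - c"
  have n: "real n = real a + real c" using assms unfolding a_def by simp
  have "2 * real (card (triples a c)) = real (a * (a + 1) * c)"
    using card_triples[of a c] by (metis of_nat_mult of_nat_numeral)
  also have "\<dots> = (real a)\<^sup>2 * real c + real a * real c"
    by (simp add: power2_eq_square algebra_simps)
  also have "\<dots> \<le> 4 / 27 * real n ^ 3 + 2 * real n ^ 2"
  proof (rule add_mono)
    show "(real a)\<^sup>2 * real c \<le> 4 / 27 * real n ^ 3"
      using cubic_bound[of "real a" "real c"] n by simp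
    have "real a * real c \<le> real n * real n" by (intro mult_mono) (use n in auto)
    then show "real a * real c \<le> 2 * real n ^ 2"
      using zero_le_square[of "real n"] unfolding power2_eq_square by linarith
  qed
  finally show ?thesis unfolding a_def by simp
qed

text \<open>The 5 is 3 + 1 + 1: three fixed layers of \<open>B\<close>, the error n^2 of
  \<open>card_triples_le\<close>, and the n + 1 choices of \<open>c\<close>, at most p^n \<le>
  p^(n^2) in number.\<close>

lemma card_codes_le:
  assumes p: "p > 1" and n: "n \<ge> 1"
  shows "real (card (codes p n s)) \<le> real p powr (2 / 27 * real n ^ 3 + (real s + 5) * real n ^ 2)"
proof -
  let ?E = "2 / 27 * real n ^ 3 + real n ^ 2"
  have p1: "real p > 1" using p by simp
  have pw: "real (p ^ k) = real p powr real k" for k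
    using p1 by (simp add: powr_realpow)
  have "real (card (codes p n s)) =
    (\<Sum>c\<le>n. real p powr ((real s + 3) * real n ^ 2) * real p powr real (card (triples (n - c) c)))"
    unfolding card_codes by (simp add: pw power2_eq_square flip: of_nat_power)
  also have "\<dots> \<le> (\<Sum>c\<le>n. real p powr ((real s + 3) * real n ^ 2) * real p powr ?E)"
    by (intro sum_mono mult_left_mono powr_mono card_triples_le) (use p1 in auto)
  also have "\<dots> = real (Suc n) * (real p powr ((real s + 3) * real n ^ 2) * real p powr ?E)"
    by simp
  also have "\<dots> \<le> real p powr real n ^ 2 * (real p powr ((real s + 3) * real n ^ 2) * real p powr ?E)"
  proof (rule mult_right_mono)
    have "Suc n \<le> 2 ^ n" using less_exp[of n] by (simp add: Suc_leI)
    also have "\<dots> \<le> p ^ n" using p by (intro power_mono) auto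
    finally have "real (Suc n) \<le> real (p ^ n)" by (rule of_nat_mono)
    also have "\<dots> = real p powr real n" by (rule pw)
    also have "\<dots> \<le> real p powr real n ^ 2"
      using n p1 by (intro powr_mono) (simp_all add: power2_eq_square)
    finally show "real (Suc n) \<le> real p powr real n ^ 2" .
  qed simp
  also have "\<dots> = real p powr (2 / 27 * real n ^ 3 + (real s + 5) * real n ^ 2)"
    by (simp add: powr_add[symmetric] algebra_simps)
  finally show ?thesis .
qed

text \<open>The coefficient field occupies one coordinate; the other n - 1 are split in the optimal
  ratio 2 : 1 up to rounding, which costs O(n^2).\<close>

lemma card_triples_ge:
  assumes "n \<ge> 1"
  shows "real (card (triples (n - 1 - n div 3) (n div 3))) \<ge> 2 / 27 * real n ^ 3 - real n ^ 2"
proof -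
  define b where "b = n div 3"
  define a where "a = n - 1 - b"
  have ab: "n = a + b + 1" using assms unfolding a_def b_def by simp
  have b: "3 * real b \<ge> real n - 2" "3 * real b \<le> real n" unfolding b_def by linarith+
  have a: "real a \<ge> 2 / 3 * real n - 1" using ab b(2) by linarith
  have card: "2 * real (card (triples a b)) = real a * (real a + 1) * real b"
    using arg_cong[OF card_triples[of a b], of real] by (simp add: algebra_simps)
  have "4 / 27 * real n ^ 3 - 2 * real n ^ 2 \<le> real a * (real a + 1) * real b"
  proof (cases "n \<ge> 3")
    case True
    have "(2 / 3 * real n - 1) * (2 / 3 * real n) * ((real n - 2) / 3) \<le>
        real a * (real a + 1) * real b"
      by (intro mult_mono) (use True a b in auto)
    moreover have "(2 / 3 * real n - 1) * (2 / 3 * real n) * ((real n - 2) / 3) =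
        4 / 27 * real n ^ 3 - 14 / 27 * real n ^ 2 + 4 / 9 * real n"
      by (simp add: power2_eq_square power3_eq_cube field_simps)
    moreover have "real n ^ 2 \<ge> 0" "real n \<ge> 0" by simp_all
    ultimately show ?thesis by linarith
  next
    case False
    \<comment> \<open>For n < 3 the factors of the product estimate can be negative, but n^3 \<le> 3
      n^2 makes the claimed bound non-positive.\<close>
    then have "real n * real n ^ 2 \<le> 3 * real n ^ 2" by (intro mult_right_mono) auto
    then have "real n ^ 3 \<le> 3 * real n ^ 2" by (simp add: power2_eq_square power3_eq_cube)
    moreover have "real n ^ 2 \<ge> 0" by simp
    ultimately have "4 / 27 * real n ^ 3 - 2 * real n ^ 2 \<le> 0" by linarith
    also have "0 \<le> real a * (real a + 1) * real b" by simp
    finally show ?thesis .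
  qed
  then show ?thesis using card unfolding a_def b_def by simp
qed

theorem theorem4p8:
  fixes p :: nat
  assumes "Factorial_Ring.prime p"
  shows "\<exists>(C :: real) (\<delta> :: nat \<Rightarrow> real). \<forall>n \<ge> 1.
           real (num_comm_rings (p ^ n)) = real p powr \<delta> n \<and>
           \<bar>\<delta> n - 2 / 27 * real n ^ 3\<bar> \<le> C * real n powr (5 / 2)"
proof (intro exI allI impI)
  fix n :: nat assume n: "n \<ge> 1"
  let ?N = "num_comm_rings (p ^ n)"
  have p: "p > 1" using assms by (rule prime_gt_1_nat)
  then have p1: "real p > 1" by simp
  define s where "s = 5 * floor_sqrt n + 2 * Suc (floor_sqrt (p * n)) + 1"
  note upper = num_comm_rings_le_codes[OF assms n s_def]
  define b where "b = n div 3"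
  define a where "a = n - 1 - b"
  interpret g: graded_ring p a b using p by unfold_locales
  have "Suc (a + b) = n" using n unfolding a_def b_def by linarith
  then have gn: "g.n = n" unfolding g.n_def .
  have low: "p ^ card (triples a b) \<le> ?N * p ^ (n * n)"
    using g.card_le_num_comm_rings upper(1) unfolding gn by blast
  have pos: "?N > 0"
  proof (rule ccontr)
    assume "\<not> ?thesis"
    then have "p ^ card (triples a b) \<le> 0" using low by simp
    then show False using p by simp
  qed
  have "real ?N \<le> real p powr (2 / 27 * real n ^ 3 + (real s + 5) * real n ^ 2)"
    using upper(2) card_codes_le[OF p n, of s] by linarith
  then have le: "log p ?N \<le> 2 / 27 * real n ^ 3 + (real s + 5) * real n ^ 2"
    using p1 pos by (simp add: log_le_iff)
  have pw: "real p powr real k = real p ^ k" for k using p1 by (simp add: powr_realpow)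
  have "real (p ^ card (triples a b)) \<le> real (?N * p ^ (n * n))" using low by (rule of_nat_mono)
  then have "real p powr real (card (triples a b)) \<le> real ?N * real p powr real (n * n)"
    unfolding pw by (simp only: of_nat_mult of_nat_power)
  then have "real p powr (real (card (triples a b)) - real (n * n)) \<le> real ?N"
    using p1 by (simp add: powr_diff divide_le_eq)
  then have "real (card (triples a b)) - real (n * n) \<le> log p ?N"
    using p1 pos by (simp add: le_log_iff)
  \<comment> \<open>One n^2 is lost to rounding, the other to the factor p^(n*n) for
    isomorphisms.\<close>
  then have ge: "2 / 27 * real n ^ 3 - 2 * real n ^ 2 \<le> log p ?N"
    using card_triples_ge[OF n] unfolding a_def b_def by (simp add: power2_eq_square)
  have n52: "real n powr (5 / 2) = real n ^ 2 * sqrt (real n)"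
  proof -
    have "real n powr (5 / 2) = real n powr (2 + 1 / 2)" by simp
    also have "\<dots> = real n powr 2 * real n powr (1 / 2)" by (rule powr_add)
    finally show ?thesis using n by (simp add: powr_half_sqrt)
  qed
  have q1: "sqrt (real n) \<ge> 1" using n by simp
  have fs: "real (floor_sqrt k) \<le> sqrt (real k)" for k
    by (rule real_le_rsqrt) (metis floor_sqrt_power2_le of_nat_le_iff of_nat_power)
  have "real (floor_sqrt (p * n)) \<le> sqrt (real p) * sqrt (real n)"
    using fs[of "p * n"] by (simp add: real_sqrt_mult)
  also have "\<dots> \<le> real p * sqrt (real n)"
  proof (rule mult_right_mono)
    show "sqrt (real p) \<le> real p"
      by (rule real_le_lsqrt) (use p1 in \<open>simp_all add: power2_eq_square\<close>)
  qed simp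
  finally have "real s + 5 \<le> 5 * sqrt (real n) + 2 * (real p * sqrt (real n)) + 8"
    using fs[of n] unfolding s_def by simp
  \<comment> \<open>Since sqrt n \<ge> 1, the constant 8 is absorbed: 13 = 5 + 8.\<close>
  also have "\<dots> \<le> (13 + 2 * real p) * sqrt (real n)" using q1 by (simp add: algebra_simps)
  finally have "real s + 5 \<le> (13 + 2 * real p) * sqrt (real n)" .
  from mult_right_mono[OF this, of "real n ^ 2"]
  have "(real s + 5) * real n ^ 2 \<le> (13 + 2 * real p) * real n powr (5 / 2)"
    unfolding n52 by (simp add: mult_ac)
  moreover have "2 * real n ^ 2 \<le> (13 + 2 * real p) * real n powr (5 / 2)"
  proof -
    have "2 * real n ^ 2 * 1 \<le> 2 * real n ^ 2 * sqrt (real n)"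
      using q1 by (intro mult_left_mono) auto
    also have "\<dots> \<le> (13 + 2 * real p) * (real n ^ 2 * sqrt (real n))"
      unfolding mult.assoc[of 2] by (rule mult_right_mono) (use p1 in auto)
    finally show ?thesis unfolding n52 by simp
  qed
  ultimately have "\<bar>log p ?N - 2 / 27 * real n ^ 3\<bar> \<le> (13 + 2 * real p) * real n powr (5 / 2)"
    using le ge by linarith
  moreover have "real ?N = real p powr log p ?N" using p1 pos by simp
  ultimately show "real ?N = real p powr (\<lambda>n. log p (num_comm_rings (p ^ n))) n \<and>
      \<bar>(\<lambda>n. log p (num_comm_rings (p ^ n))) n - 2 / 27 * real n ^ 3\<bar> \<le>
        (13 + 2 * real p) * real n powr (5 / 2)"
    by simp
qed

end
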